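(* For every integer $n\ge 3$, the minimum internal interface over all partitions of the cube $[0,n]^3$ into six boxes admitting no fault plane (the boxes are not required to be pairwise distinct) is exactly \[ I_{\mathrm{ff}}(n)=2n^2+n=\binom{2n+1}{2}. \]
   Context: A partition of the cube $[0,n]^3$ into boxes means a decomposition into axis-aligned boxes with integer corners, with pairwise disjoint interiors and union $[0,n]^3$. The internal interface $I$ of a partition is the total area of the boundary between pieces inside the cube (each unit square separating two different pieces counted once). A fault plane of a partition is a plane $x_d=i$ (with $d$ one of the three coordinate directions and $i$ an integer, $0<i<n$) that meets the interior of no piece. *)

theory Defs
  imports "HOL-Analysis.Analysis"
begin

definition cube :: "nat \<Rightarrow> (real ^ 3) set" where
  "cube n = cbox 0 (\<chi> i. real n)"

definition integer_box :: "(real ^ 3) set \<Rightarrow> bool" where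
  "integer_box K \<longleftrightarrow>
     (\<exists>a b. K = cbox a b \<and> (\<forall>i. a $ i \<in> \<int> \<and> b $ i \<in> \<int> \<and> a $ i < b $ i))"

text \<open>
  The library notion \<open>division_of\<close> provides finiteness, pairwise disjoint interiors and the
  union condition, but allows degenerate boxes; these are excluded by \<open>integer_box\<close>.
  Congruent boxes in different positions are different elements of \<open>P\<close>.
\<close>
definition box_partition :: "nat \<Rightarrow> (real ^ 3) set set \<Rightarrow> bool" where
  "box_partition n P \<longleftrightarrow> P division_of (cube n) \<and> (\<forall>K\<in>P. integer_box K)"

definition unit_square :: "(real ^ 3) set \<Rightarrow> bool" where
  "unit_square S \<longleftrightarrow>
     (\<exists>d a. (\<forall>i. a $ i \<in> \<int>) \<and> S = cbox a (\<chi> i. if i = d then a $ i else a $ i + 1))"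

text \<open>
  Two different pieces have disjoint interiors, so a unit square contained in both lies
  between them; in particular it is never part of the boundary of the cube. Since all corners
  are integral, the number of such squares is the total area of the interface.
\<close>
definition internal_interface :: "(real ^ 3) set set \<Rightarrow> nat" where
  "internal_interface P =
     card {S. unit_square S \<and> (\<exists>K\<in>P. \<exists>L\<in>P. K \<noteq> L \<and> S \<subseteq> K \<and> S \<subseteq> L)}"

definition fault_plane :: "nat \<Rightarrow> (real ^ 3) set set \<Rightarrow> 3 \<Rightarrow> int \<Rightarrow> bool" where
  "fault_plane n P d i \<longleftrightarrow>
     0 < i \<and> i < int n \<and> (\<forall>K\<in>P. {x. x $ d = of_int i} \<inter> interior K = {})"

definition fault_free_six_partition :: "nat \<Rightarrow> (real ^ 3) set set \<Rightarrow> bool" where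
  "fault_free_six_partition n P \<longleftrightarrow>
     box_partition n P \<and> card P = 6 \<and> (\<nexists>d i. fault_plane n P d i)"

text \<open>This is a genuine minimum only if some fault-free partition into six boxes exists.\<close>
definition I_ff :: "nat \<Rightarrow> nat" where
  "I_ff n = (LEAST m. \<exists>P. fault_free_six_partition n P \<and> internal_interface P = m)"

end

theory Submission imports Defs
begin

text \<open>
  Cut the cube into \<open>n\<^sup>3\<close> unit cells and, for each of the three directions, into \<open>n\<^sup>2\<close> lines of
  cells. The interface is the total number of breaks along these lines, a break being a place where
  a line passes from one box to another. A line has no break exactly if a box containing it spans the
  cube in its direction. So, with \<open>S\<close> the number of spanned lines and \<open>M\<close> the number of lines
  with at least two breaks, the interface is at least \<open>3n\<^sup>2 - S + M\<close>, and what must be shown is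
  \<open>S + n \<le> n\<^sup>2 + M\<close>. In a fault-free tiling no box spans two directions, since it would be a slab
  bounded by a fault plane. There are three cases (up to permuting the directions).

  \<^item> All three directions are spanned. The boxes spanning \<open>x\<close> and those spanning \<open>y\<close> have disjoint
    projections to the \<open>z\<close>-axis, and similarly for the other pairs. Bounding the number of spanned
    lines in each direction by a product of lengths of projections gives \<open>S \<le> n\<^sup>2 - n + 1\<close>
    (\<open>cyclic_product_bound\<close>). Moreover \<open>M \<ge> 1\<close>: otherwise each box contains a
    corner cell of the cube, the three spanning boxes contain two each, and there are at most
    \<open>8 - 3 = 5\<close> boxes (\<open>exists_inner_box\<close>). This is the only place where the number of boxes
    matters beyond its being at least two.
  \<^item> Exactly \<open>x\<close> and \<open>y\<close> are spanned. No layer orthogonal to \<open>z\<close> contains spanned lines of both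
    directions, so each layer contains at most \<open>n\<close> of them. If every layer contains fewer than \<open>n\<close>,
    then \<open>S + n \<le> n\<^sup>2\<close>. If some layer consists of \<open>n\<close> lines spanned in direction \<open>x\<close>, take any layer
    containing lines spanned in direction \<open>y\<close>: through each of these lines passes a
    \<open>z\<close>-line with two breaks, as otherwise the tops (or bottoms) of the boxes of the full layer form
    a fault plane (\<open>full_layer_meets\<close>). So \<open>M\<close> compensates the spanned lines of this one layer.
  \<^item> At most \<open>x\<close> is spanned. If every slice orthogonal to \<open>x\<close> contains a line with two breaks, then
    \<open>M \<ge> n\<close>. Otherwise some slice is cut into four rectangles, two of whose cuts are aligned
    (\<open>slice_fault\<close>). A box elsewhere that crosses the plane through the aligned cuts yields
    \<open>n\<close> lines in direction \<open>x\<close> that are not spanned (\<open>straight_cut_bound\<close>).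

  For the upper bound, five boxes, among them one bar in each direction, form a fault-free tiling
  with interface \<open>2n\<^sup>2 + n - 1\<close>. One of them is a \<open>1 \<times> 1 \<times> (n - 1)\<close> bar, and for \<open>n \<ge> 3\<close> this can be
  split in two at the cost of one unit square.
\<close>

section \<open>Cells and boxes\<close>

text \<open>A unit cell is given by its lower corner; a box is given by its lower and upper corners.\<close>
type_synonym cell = "3 \<Rightarrow> nat"

abbreviation lo :: "cell \<times> cell \<Rightarrow> cell" where "lo K \<equiv> fst K"
abbreviation hi :: "cell \<times> cell \<Rightarrow> cell" where "hi K \<equiv> snd K"

text \<open>The unit cells of which a box consists.\<close>
definition cells :: "cell \<times> cell \<Rightarrow> cell set" where
  "cells K = {v. \<forall>i. lo K i \<le> v i \<and> v i < hi K i}"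

text \<open>The box reaches from one face of the cube of side \<open>n\<close> to the opposite one, in direction \<open>d\<close>.\<close>
definition spans :: "nat \<Rightarrow> 3 \<Rightarrow> cell \<times> cell \<Rightarrow> bool" where
  "spans n d K \<longleftrightarrow> lo K d = 0 \<and> hi K d = n"

lemma cells_upd:
  assumes "v \<in> cells K" "lo K d \<le> t" "t < hi K d"
  shows "v(d := t) \<in> cells K"
  using assms by (simp add: cells_def)

text \<open>
  The three coordinate directions enter symmetrically; arguments that single out some of them are
  carried out for an arbitrary enumeration \<open>a, b, c\<close> of the three.
\<close>
lemma UNIV_distinct3:
  assumes "distinct [a, b, c :: 3]"
  shows "UNIV = {a, b, c}"
proof -
  have "card {a, b, c} = card (UNIV :: 3 set)" using assms by simp
  then have "{a, b, c} = UNIV" by (intro card_subset_eq) auto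
  then show ?thesis by simp
qed

lemma forall_distinct3:
  assumes "distinct [a, b, c :: 3]"
  shows "(\<forall>i. R i) \<longleftrightarrow> R a \<and> R b \<and> R c"
proof -
  have "(\<forall>i. R i) \<longleftrightarrow> (\<forall>i\<in>UNIV. R i)" by simp
  also have "\<dots> \<longleftrightarrow> R a \<and> R b \<and> R c" unfolding UNIV_distinct3[OF assms] by simp
  finally show ?thesis .
qed

lemma sum_distinct3:
  fixes f :: "3 \<Rightarrow> nat"
  assumes "distinct [a, b, c]"
  shows "sum f UNIV = f a + f b + f c"
  unfolding UNIV_distinct3[OF assms] using assms by (simp add: add.assoc)

section \<open>Counting lemmas\<close>

lemma card_by_value:
  assumes "finite A" and "\<And>v. v \<in> A \<Longrightarrow> f v < (n :: nat)"
  shows "card A = (\<Sum>k<n. card {v \<in> A. f v = k})"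
proof -
  have "A = (\<Union>k<n. {v \<in> A. f v = k})" using assms(2) by auto
  then have "card A = card (\<Union>k<n. {v \<in> A. f v = k})" by simp
  also have "\<dots> = (\<Sum>k<n. card {v \<in> A. f v = k})"
    by (rule card_UN_disjoint) (use assms(1) in auto)
  finally show ?thesis .
qed

text \<open>
  The left-hand side is multilinear, so its maximum over the integer points with entries at least
  \<open>1\<close> is attained at a vertex, where the bound is checked directly. The proof below instead
  substitutes \<open>u = 1 + p\<close>, \<open>v = 1 + q\<close>, \<open>w = 1 + r\<close> and, with \<open>m = n - 2\<close>, reduces the claim to
  \<open>pq + q'r + r'p' \<le> m\<^sup>2\<close>. Multiplied by \<open>m\<close>, the left-hand side of this becomes a sum of
  distinct monomials of the expansion of \<open>(p + p')(q + q')(r + r') = m\<^sup>3\<close>.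
\<close>
lemma cyclic_product_bound:
  fixes u u' v v' w w' n :: nat
  assumes pos: "0 < u" "0 < u'" "0 < v" "0 < v'" "0 < w" "0 < w'"
    and sums: "u + u' \<le> n" "v + v' \<le> n" "w + w' \<le> n"
  shows "u * v + v' * w + w' * u' + n \<le> n\<^sup>2 + 1"
proof -
  define m where "m = n - 2"
  have m: "n = m + 2" using pos(1,2) sums(1) by (simp add: m_def)
  define p where "p = int u - 1"
  define q where "q = int v - 1"
  define r where "r = int w - 1"
  define p' where "p' = int m - p"
  define q' where "q' = int m - q"
  define r' where "r' = int m - r"
  have nn: "0 \<le> p" "0 \<le> q" "0 \<le> r" "0 \<le> p'" "0 \<le> q'" "0 \<le> r'"
    using pos sums m by (auto simp: p_def q_def r_def p'_def q'_def r'_def)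
  have bnd: "int u = 1 + p" "int v = 1 + q" "int w = 1 + r"
    "int u' \<le> 1 + p'" "int v' \<le> 1 + q'" "int w' \<le> 1 + r'"
    using sums m by (auto simp: p_def q_def r_def p'_def q'_def r'_def)
  have mm: "int m = p + p'" "int m = q + q'" "int m = r + r'"
    by (auto simp: p'_def q'_def r'_def)
  have key: "p * q + q' * r + r' * p' \<le> int m * int m"
  proof (cases "m = 0")
    case True
    then have "p = 0" "q = 0" "r = 0" "p' = 0" "q' = 0" "r' = 0" using nn mm by auto
    then show ?thesis by simp
  next
    case False
    have "int m * (p * q + q' * r + r' * p')
      = p * q * (r + r') + q' * r * (p + p') + r' * p' * (q + q')"
      using mm by (simp add: algebra_simps)
    also have "\<dots> \<le> (p + p') * ((q + q') * (r + r'))"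
      using nn by (simp add: algebra_simps)
    also have "\<dots> = int m * (int m * int m)" using mm by simp
    finally show ?thesis using False by simp
  qed
  have "int (u * v + v' * w + w' * u' + n) = int u * int v + int v' * int w + int w' * int u' + int n"
    by simp
  also have "\<dots> \<le> (1 + p) * (1 + q) + (1 + q') * (1 + r) + (1 + r') * (1 + p') + int n"
    using bnd nn by (intro add_mono mult_mono) auto
  also have "\<dots> = (p * q + q' * r + r' * p') + 3 + (p + p') + (q + q') + (r + r') + int n"
    by (simp add: algebra_simps)
  also have "\<dots> \<le> int m * int m + 3 + 3 * int m + int n"
    using key mm by linarith
  also have "\<dots> = int (n\<^sup>2 + 1)"
    by (simp add: m power2_eq_square algebra_simps)
  finally show ?thesis by linarith
qed

lemma sum_one_exception:
  fixes g :: "nat \<Rightarrow> nat"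
  assumes "\<And>k. g k \<le> n" and "j < n"
  shows "(\<Sum>k<n. g k) + n \<le> n\<^sup>2 + g j"
proof -
  have "(\<Sum>k<n. g k) = g j + (\<Sum>k\<in>{..<n} - {j}. g k)"
    using assms(2) by (intro sum.remove) auto
  moreover have "(\<Sum>k\<in>{..<n} - {j}. g k) \<le> (n - 1) * n"
    using sum_bounded_above[of "{..<n} - {j}" g n] assms by simp
  moreover have "(n - 1) * n + n = n\<^sup>2" using assms(2) by (cases n) (auto simp: power2_eq_square)
  ultimately show ?thesis by linarith
qed

section \<open>Tilings of the cube and breaks along lines\<close>

text \<open>
  A set of nondegenerate boxes inside the cube of side \<open>n\<close> such that each cell of the cube lies in
  exactly one of them.
\<close>
locale cube_tiling =
  fixes n :: nat and Q :: "(cell \<times> cell) set"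
  assumes finite_Q: "finite Q"
    and lo_less_hi: "K \<in> Q \<Longrightarrow> lo K i < hi K i"
    and hi_le: "K \<in> Q \<Longrightarrow> hi K i \<le> n"
    and unique_box: "(\<And>i. v i < n) \<Longrightarrow> \<exists>!K. K \<in> Q \<and> v \<in> cells K"
begin

text \<open>All cells of the cube.\<close>
definition cube_cells :: "cell set" where "cube_cells = {v. \<forall>i. v i < n}"

text \<open>The box that contains a given cell; it is meaningful only for cells of the cube.\<close>
definition box_at :: "cell \<Rightarrow> cell \<times> cell" where
  "box_at v = (THE K. K \<in> Q \<and> v \<in> cells K)"

text \<open>
  The interface as a set: \<open>(d, v)\<close> stands for the face between the cell \<open>v\<close> and its successor in
  direction \<open>d\<close>, when these two cells lie in different boxes.
\<close>
definition faces :: "(3 \<times> cell) set" where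
  "faces = {(d, v). v \<in> cube_cells \<and> Suc (v d) < n \<and>
     \<not> (\<exists>K\<in>Q. v \<in> cells K \<and> v(d := Suc (v d)) \<in> cells K)}"

text \<open>The lines of cells in direction \<open>d\<close>, each represented by its first cell.\<close>
definition lines :: "3 \<Rightarrow> cell set" where "lines d = {v \<in> cube_cells. v d = 0}"

text \<open>
  The places where the line through \<open>v\<close> in direction \<open>d\<close> passes to another box. The value does not
  depend on the \<open>d\<close>-coordinate of \<open>v\<close>.
\<close>
definition breaks :: "3 \<Rightarrow> cell \<Rightarrow> nat set" where
  "breaks d v = {t. Suc t < n \<and> box_at (v(d := t)) \<noteq> box_at (v(d := Suc t))}"

text \<open>The lines in direction \<open>d\<close> that lie in a single box.\<close>
definition spanned :: "3 \<Rightarrow> cell set" where "spanned d = {v \<in> lines d. spans n d (box_at v)}"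

text \<open>The lines in direction \<open>d\<close> that meet at least three boxes.\<close>
definition multi_broken :: "3 \<Rightarrow> cell set" where
  "multi_broken d = {v \<in> lines d. 2 \<le> card (breaks d v)}"

lemma cube_cells_upd: "v \<in> cube_cells \<Longrightarrow> t < n \<Longrightarrow> v(d := t) \<in> cube_cells"
  by (simp add: cube_cells_def)

lemma cells_subset_cube: "K \<in> Q \<Longrightarrow> cells K \<subseteq> cube_cells"
  unfolding cells_def cube_cells_def using hi_le[of K] by (auto intro: less_le_trans)

lemma lo_in_cells: "K \<in> Q \<Longrightarrow> lo K \<in> cells K"
  by (simp add: cells_def lo_less_hi)

lemma box_at:
  assumes "v \<in> cube_cells"
  shows box_at_in: "box_at v \<in> Q" and in_box_at: "v \<in> cells (box_at v)"
proof -
  have "\<exists>!K. K \<in> Q \<and> v \<in> cells K" using assms by (intro unique_box) (simp add: cube_cells_def)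
  from theI'[OF this] show "box_at v \<in> Q" "v \<in> cells (box_at v)"
    by (auto simp: box_at_def)
qed

lemma box_unique:
  assumes "K \<in> Q" "K' \<in> Q" "v \<in> cells K" "v \<in> cells K'"
  shows "K = K'"
proof -
  have "\<exists>!K. K \<in> Q \<and> v \<in> cells K"
    using cells_subset_cube[OF assms(1)] assms(3) by (intro unique_box) (auto simp: cube_cells_def)
  then show ?thesis using assms by blast
qed

lemma box_at_eq:
  assumes "K \<in> Q" "v \<in> cells K"
  shows "box_at v = K"
  using box_unique[OF _ assms(1) _ assms(2)] box_at[of v] cells_subset_cube[OF assms(1)] assms(2)
  by blast

lemma cells_spans_upd:
  assumes "v \<in> cells K" "spans n d K" "t < n"
  shows "v(d := t) \<in> cells K"
  using assms by (simp add: cells_def spans_def)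

text \<open>
  A box that does not reach a face of the cube causes a break at its own end, on each line through
  it. Hence on a line with at most one break each box reaches one of the two faces.
\<close>
lemma lo_break:
  assumes "K \<in> Q" "v \<in> cells K" "0 < lo K d"
  shows "lo K d - 1 \<in> breaks d v"
proof -
  have "Suc (lo K d - 1) = lo K d" using assms(3) by simp
  moreover have "box_at (v(d := lo K d)) = K"
    using assms lo_less_hi[OF assms(1)] by (intro box_at_eq cells_upd) auto
  moreover have "lo K d < n" using lo_less_hi[OF assms(1)] hi_le[OF assms(1)] less_le_trans by blast
  moreover have "box_at (v(d := lo K d - 1)) \<noteq> K"
  proof
    assume "box_at (v(d := lo K d - 1)) = K"
    moreover have "v(d := lo K d - 1) \<in> cube_cells"
      using assms cells_subset_cube[OF assms(1)] \<open>lo K d < n\<close> by (intro cube_cells_upd) auto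
    ultimately have "v(d := lo K d - 1) \<in> cells K" using in_box_at by metis
    then have "lo K d \<le> lo K d - 1" by (auto simp: cells_def dest: spec[of _ d])
    then show False using assms(3) by simp
  qed
  ultimately show ?thesis by (simp add: breaks_def)
qed

lemma hi_break:
  assumes "K \<in> Q" "v \<in> cells K" "hi K d < n"
  shows "hi K d - 1 \<in> breaks d v"
proof -
  have "0 < hi K d" using lo_less_hi[OF assms(1), of d] by simp
  then have eq: "Suc (hi K d - 1) = hi K d" by simp
  have "lo K d \<le> hi K d - 1" using lo_less_hi[OF assms(1), of d] by simp
  then have "box_at (v(d := hi K d - 1)) = K"
    using assms \<open>0 < hi K d\<close> by (intro box_at_eq cells_upd) auto
  moreover have "box_at (v(d := hi K d)) \<noteq> K"
  proof
    assume "box_at (v(d := hi K d)) = K"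
    moreover have "v(d := hi K d) \<in> cube_cells"
      using assms cells_subset_cube[OF assms(1)] by (intro cube_cells_upd) auto
    ultimately have "v(d := hi K d) \<in> cells K" using in_box_at by metis
    then show False by (auto simp: cells_def dest: spec[of _ d])
  qed
  ultimately show ?thesis using assms(3) eq by (simp add: breaks_def)
qed

lemma finite_breaks [simp]: "finite (breaks d v)"
  by (rule finite_subset[of _ "{..<n}"]) (auto simp: breaks_def)

lemma breaks_upd [simp]: "breaks d (v(d := t)) = breaks d v"
  by (simp add: breaks_def)

lemma finite_cube_cells [simp]: "finite cube_cells"
proof -
  have "cube_cells = PiE UNIV (\<lambda>_. {..<n})" by (auto simp: cube_cells_def PiE_def)
  then show ?thesis by (simp add: finite_PiE)
qed

lemma finite_lines [simp]: "finite (lines d)" by (simp add: lines_def)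
lemma finite_spanned [simp]: "finite (spanned d)" by (simp add: spanned_def)
lemma finite_multi_broken [simp]: "finite (multi_broken d)" by (simp add: multi_broken_def)

lemma lines_eqI:
  assumes "distinct [a, b, c]" "v \<in> lines a" "w \<in> lines a" "v b = w b" "v c = w c"
  shows "v = w"
  unfolding fun_eq_iff forall_distinct3[OF assms(1)] using assms by (simp add: lines_def)

lemma card_lines: "card (lines a) = n\<^sup>2"
proof -
  have "\<exists>b c. distinct [a, b, c]"
  proof -
    have "distinct [1, 2, 3 :: 3]" "distinct [2, 1, 3 :: 3]" "distinct [3, 1, 2 :: 3]" by simp_all
    then show ?thesis using exhaust_3[of a] by blast
  qed
  then obtain b c where abc: "distinct [a, b, c]" by blast
  have "bij_betw (\<lambda>v. (v b, v c)) (lines a) ({..<n} \<times> {..<n})"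
  proof (rule bij_betw_imageI)
    show "inj_on (\<lambda>v. (v b, v c)) (lines a)"
      by (rule inj_onI) (use lines_eqI[OF abc] in auto)
    show "(\<lambda>v. (v b, v c)) ` lines a = {..<n} \<times> {..<n}"
    proof
      show "(\<lambda>v. (v b, v c)) ` lines a \<subseteq> {..<n} \<times> {..<n}" by (auto simp: lines_def cube_cells_def)
      show "{..<n} \<times> {..<n} \<subseteq> (\<lambda>v. (v b, v c)) ` lines a"
      proof
        fix p assume p: "p \<in> {..<n} \<times> {..<n}"
        let ?v = "(\<lambda>_. 0)(b := fst p, c := snd p)"
        have "?v \<in> lines a" using p abc by (auto simp: lines_def cube_cells_def)
        moreover have "p = (?v b, ?v c)" using abc by auto
        ultimately show "p \<in> (\<lambda>v. (v b, v c)) ` lines a" by blast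
      qed
    qed
  qed
  then show ?thesis by (simp add: bij_betw_same_card power2_eq_square)
qed

text \<open>Each line has at least one break, with one less if it is spanned and one more if it is
  multiply broken.\<close>
lemma line_count: "n\<^sup>2 + card (multi_broken d) \<le> (\<Sum>v\<in>lines d. card (breaks d v)) + card (spanned d)"
proof -
  have ind: "card {v \<in> lines d. R v} = (\<Sum>v\<in>lines d. if R v then 1 else 0)" for R
    by (simp add: sum.If_cases Int_def)
  have "n\<^sup>2 + card (multi_broken d) = (\<Sum>v\<in>lines d. 1 + (if 2 \<le> card (breaks d v) then 1 else 0))"
    by (subst sum.distrib) (simp add: card_lines multi_broken_def ind)
  also have "\<dots> \<le> (\<Sum>v\<in>lines d. card (breaks d v) + (if spans n d (box_at v) then 1 else 0))"
  proof (rule sum_mono)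
    fix v assume v: "v \<in> lines d"
    then have vC: "v \<in> cube_cells" by (simp add: lines_def)
    have "breaks d v \<noteq> {}" if "\<not> spans n d (box_at v)"
    proof -
      have "0 < lo (box_at v) d \<or> hi (box_at v) d < n"
        using that hi_le[OF box_at_in[OF vC], of d] by (auto simp: spans_def)
      then show ?thesis
        using lo_break[OF box_at[OF vC], of d] hi_break[OF box_at[OF vC], of d] by blast
    qed
    then have "0 < card (breaks d v)" if "\<not> spans n d (box_at v)"
      using that by (simp add: card_gt_0_iff)
    then show "1 + (if 2 \<le> card (breaks d v) then 1 else 0)
        \<le> card (breaks d v) + (if spans n d (box_at v) then 1 else 0)" by auto
  qed
  also have "\<dots> = (\<Sum>v\<in>lines d. card (breaks d v)) + card (spanned d)"
    by (simp add: sum.distrib spanned_def ind)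
  finally show ?thesis .
qed

lemma finite_faces [simp]: "finite faces"
  by (rule finite_subset[of _ "UNIV \<times> cube_cells"]) (auto simp: faces_def)

lemma sum_breaks_le_card_faces: "(\<Sum>d\<in>UNIV. \<Sum>v\<in>lines d. card (breaks d v)) \<le> card faces"
proof -
  let ?X = "SIGMA d:UNIV. SIGMA v:lines d. breaks d v"
  let ?f = "\<lambda>(d, v, t). (d, v(d := t))"
  have "(\<Sum>d\<in>UNIV. \<Sum>v\<in>lines d. card (breaks d v)) = card ?X"
    by (simp add: card_SigmaI)
  also have "\<dots> \<le> card faces"
  proof (rule card_inj_on_le)
    show "inj_on ?f ?X"
    proof (rule inj_onI, clarsimp)
      fix d v t w s
      assume vw: "v \<in> lines d" "w \<in> lines d" and eq: "v(d := t) = w(d := s)"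
      have "v i = w i" for i
        using fun_cong[OF eq, of i] vw by (cases "i = d") (auto simp: lines_def)
      moreover have "t = s" using fun_cong[OF eq, of d] by simp
      ultimately show "v = w \<and> t = s" by auto
    qed
    show "?f ` ?X \<subseteq> faces"
    proof (clarsimp simp: faces_def)
      fix d v t assume v: "v \<in> lines d" and t: "t \<in> breaks d v"
      have "box_at (v(d := t)) \<noteq> box_at (v(d := Suc t))" "Suc t < n"
        using t by (auto simp: breaks_def)
      moreover have "v \<in> cube_cells" using v by (simp add: lines_def)
      ultimately show "v(d := t) \<in> cube_cells \<and> Suc t < n \<and>
          (\<forall>K\<in>Q. v(d := t) \<in> cells K \<longrightarrow> v(d := Suc t) \<notin> cells K)"
        using box_at_eq cube_cells_upd Suc_lessD by metis
    qed
  qed simp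
  finally show ?thesis .
qed


text \<open>
  The interface is at least \<open>3n\<^sup>2 - S + M\<close>, where \<open>S\<close> counts the spanned and \<open>M\<close> the multiply broken
  lines.
\<close>
lemma faces_bound:
  assumes abc: "distinct [a, b, c]"
  shows "3 * n\<^sup>2 + card (multi_broken a) + card (multi_broken b) + card (multi_broken c)
    \<le> card faces + card (spanned a) + card (spanned b) + card (spanned c)"
  using line_count[of a] line_count[of b] line_count[of c] sum_breaks_le_card_faces
  unfolding sum_distinct3[OF abc] by linarith

lemma spanned_empty: "(\<And>K. K \<in> Q \<Longrightarrow> \<not> spans n d K) \<Longrightarrow> spanned d = {}"
  using box_at_in by (auto simp: spanned_def lines_def)

end

section \<open>Fault-free tilings\<close>

text \<open>
  Tilings by at least six boxes without fault planes: each inner plane is crossed by some box.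
\<close>
locale fault_free_tiling = cube_tiling +
  assumes six_le_card: "6 \<le> card Q"
    and crossed: "0 < t \<Longrightarrow> t < n \<Longrightarrow> \<exists>K\<in>Q. lo K d < t \<and> t < hi K d"
begin

text \<open>A box that spans two directions is a slab, whose faces lie in fault planes.\<close>
lemma not_spans_two:
  assumes K: "K \<in> Q" and "a \<noteq> b" and sp: "spans n a K" "spans n b K"
  shows False
proof -
  obtain c where abc: "distinct [a, b, c]"
  proof -
    have "card {a, b} < card (UNIV :: 3 set)" using \<open>a \<noteq> b\<close> by simp
    then have "{a, b} \<noteq> UNIV" by (metis less_irrefl)
    then obtain c where "c \<notin> {a, b}" by blast
    then show ?thesis using that[of c] \<open>a \<noteq> b\<close> by (simp add: eq_commute)
  qed
  have inK: "w \<in> cells K" if "w \<in> cube_cells" "lo K c \<le> w c" "w c < hi K c" for w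
    using that sp unfolding cells_def mem_Collect_eq forall_distinct3[OF abc]
    by (auto simp: spans_def cube_cells_def)
  consider "0 < lo K c" | "hi K c < n" | "lo K c = 0" "hi K c = n"
    using hi_le[OF K, of c] by fastforce
  then show False
  proof cases
    case 1
    have "lo K c < n" using lo_less_hi[OF K] hi_le[OF K] less_le_trans by blast
    then obtain K' where K': "K' \<in> Q" "lo K' c < lo K c" "lo K c < hi K' c"
      using crossed[OF 1] by blast
    let ?w = "(lo K')(c := lo K c)"
    have w: "?w \<in> cells K'" using K' by (intro cells_upd lo_in_cells) auto
    then have "?w \<in> cube_cells" using cells_subset_cube[OF K'(1)] by blast
    then have "?w \<in> cells K" using lo_less_hi[OF K] by (intro inK) auto
    then have "K = K'" using w box_unique K K'(1) by blast
    then show False using K' by simp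
  next
    case 2
    have "0 < hi K c" using lo_less_hi[OF K, of c] by simp
    then obtain K' where K': "K' \<in> Q" "lo K' c < hi K c" "hi K c < hi K' c"
      using crossed[OF _ 2] by blast
    let ?w = "(lo K')(c := hi K c - 1)"
    have w: "?w \<in> cells K'" using K' by (intro cells_upd lo_in_cells) auto
    then have "?w \<in> cube_cells" using cells_subset_cube[OF K'(1)] by blast
    then have "?w \<in> cells K" using lo_less_hi[OF K, of c] by (intro inK) auto
    then have "K = K'" using w box_unique K K'(1) by blast
    then show False using K' by simp
  next
    case 3
    have "Q \<subseteq> {K}"
    proof
      fix K' assume K': "K' \<in> Q"
      have w: "lo K' \<in> cells K'" using K' by (rule lo_in_cells)
      then have "lo K' \<in> cube_cells" using cells_subset_cube[OF K'] by blast
      then have "lo K' \<in> cells K" using 3 by (intro inK) (auto simp: cube_cells_def)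
      then show "K' \<in> {K}" using w box_unique K K' by blast
    qed
    then have "card Q \<le> 1" using card_mono[of "{K}" Q] by simp
    then show False using six_le_card by simp
  qed
qed

subsection \<open>Spanning boxes in all three directions\<close>

text \<open>The projection to the \<open>b\<close>-axis of the union of the boxes that span direction \<open>a\<close>.\<close>
definition shadow :: "3 \<Rightarrow> 3 \<Rightarrow> nat set" where
  "shadow a b = {t. \<exists>K\<in>Q. spans n a K \<and> lo K b \<le> t \<and> t < hi K b}"

lemma shadow_subset: "shadow a b \<subseteq> {..<n}"
  by (auto simp del: split_paired_Ex simp: shadow_def dest!: hi_le[of _ b] intro: less_le_trans)

lemma finite_shadow [simp]: "finite (shadow a b)"
  using shadow_subset finite_subset by blast

lemma card_shadow_pos:
  assumes "K \<in> Q" "spans n a K"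
  shows "0 < card (shadow a b)"
proof -
  have "lo K b \<in> shadow a b" using assms lo_less_hi[OF assms(1)] by (auto simp: shadow_def)
  then show ?thesis using finite_shadow card_gt_0_iff by blast
qed

text \<open>
  If boxes spanning \<open>a\<close> and \<open>b\<close> both meet the layer at height \<open>t\<close> in direction \<open>c\<close>, then they
  intersect in this layer, so they are one box that spans two directions.
\<close>
lemma shadows_disjoint:
  assumes abc: "distinct [a, b, c]"
  shows "shadow a c \<inter> shadow b c = {}"
proof (rule ccontr)
  assume "shadow a c \<inter> shadow b c \<noteq> {}"
  then obtain t K K' where K: "K \<in> Q" "spans n a K" "lo K c \<le> t" "t < hi K c"
    and K': "K' \<in> Q" "spans n b K'" "lo K' c \<le> t" "t < hi K' c"
    by (auto simp: shadow_def)
  let ?v = "(lo K)(a := lo K' a, c := t)"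
  have "lo K b < n" "lo K' a < n"
    using lo_less_hi hi_le K(1) K'(1) less_le_trans by metis+
  then have "?v \<in> cells K" "?v \<in> cells K'"
    unfolding cells_def mem_Collect_eq forall_distinct3[OF abc] using abc K K' lo_less_hi
    by (auto simp: spans_def)
  then have "K = K'" using box_unique K(1) K'(1) by blast
  then show False using not_spans_two[OF K(1), of a b] K(2) K'(2) abc by auto
qed

lemma card_shadows:
  assumes "distinct [a, b, c]"
  shows "card (shadow a c) + card (shadow b c) \<le> n"
proof -
  have "card (shadow a c \<union> shadow b c) \<le> card {..<n}"
    using shadow_subset by (intro card_mono) auto
  then show ?thesis using shadows_disjoint[OF assms] by (simp add: card_Un_disjoint)
qed

lemma card_spanned_le:
  assumes abc: "distinct [a, b, c]"
  shows "card (spanned a) \<le> card (shadow a b) * card (shadow a c)"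
proof -
  have "card (spanned a) \<le> card (shadow a b \<times> shadow a c)"
  proof (rule card_inj_on_le[of "\<lambda>v. (v b, v c)"])
    show "inj_on (\<lambda>v. (v b, v c)) (spanned a)"
      by (rule inj_onI) (use lines_eqI[OF abc] in \<open>auto simp: spanned_def\<close>)
    show "(\<lambda>v. (v b, v c)) ` spanned a \<subseteq> shadow a b \<times> shadow a c"
      using box_at by (fastforce simp: spanned_def lines_def shadow_def cells_def)
  qed simp
  then show ?thesis by (simp add: card_cartesian_product)
qed

text \<open>
  Some box reaches neither of two opposite faces. Otherwise each box contains a corner cell; a box
  that spans some direction contains two of them; and three of the at least six boxes do, although
  there are only eight corner cells.
\<close>
lemma exists_inner_box:
  assumes abc: "distinct [a, b, c]"
    and sp: "A \<in> Q" "spans n a A" "B \<in> Q" "spans n b B" "D \<in> Q" "spans n c D"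
  shows "\<exists>K\<in>Q. \<exists>d. 0 < lo K d \<and> hi K d < n"
proof (rule ccontr)
  assume "\<not> ?thesis"
  then have touch: "lo K d = 0 \<or> hi K d = n" if "K \<in> Q" for K d
    using that hi_le[of K d] by (metis gr0I le_neq_implies_less)
  have n0: "0 < n" using lo_less_hi[OF sp(1), of a] hi_le[OF sp(1), of a] by linarith
  define corner where "corner = (\<lambda>s :: 3 \<Rightarrow> bool. \<lambda>i. if s i then n - 1 else 0)"
  have cC: "corner s \<in> cube_cells" for s using n0 by (auto simp: corner_def cube_cells_def)
  \<comment> \<open>The corner cells in \<open>K\<close>, indexed by the directions in which they are at the upper end.\<close>
  define F where "F = (\<lambda>K. {s. box_at (corner s) = K})"
  have canon: "(\<lambda>i. 0 < lo K i) \<in> F K" if K: "K \<in> Q" for K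
  proof -
    have "lo K i \<le> corner (\<lambda>i. 0 < lo K i) i \<and> corner (\<lambda>i. 0 < lo K i) i < hi K i" for i
      using lo_less_hi[OF K, of i] touch[OF K, of i] by (auto simp: corner_def)
    then have "corner (\<lambda>i. 0 < lo K i) \<in> cells K" by (simp add: cells_def)
    then show ?thesis using box_at_eq[OF K] by (simp add: F_def)
  qed
  have two: "2 \<le> card (F K)" if K: "K \<in> Q" and d: "spans n d K" for K d
  proof -
    define s where "s = (\<lambda>i. 0 < lo K i)"
    have s: "s \<in> F K" using canon[OF K] by (simp add: s_def)
    let ?t = "s(d := \<not> s d)"
    have "corner s \<in> cells K" using s in_box_at[OF cC] by (auto simp: F_def)
    moreover have "corner ?t = (corner s)(d := if s d then 0 else n - 1)"
      by (auto simp: corner_def)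
    ultimately have "corner ?t \<in> cells K"
      using cells_spans_upd[OF _ d] n0 by simp
    then have t: "?t \<in> F K" using box_at_eq[OF K] by (simp add: F_def)
    have "s \<noteq> ?t" by (auto simp: fun_eq_iff)
    then have "card {s, ?t} = 2" by simp
    moreover have "card {s, ?t} \<le> card (F K)" using s t by (intro card_mono) auto
    ultimately show ?thesis by simp
  qed
  have one: "1 \<le> card (F K)" if K: "K \<in> Q" for K
  proof -
    have "card (F K) \<noteq> 0" using canon[OF K] by auto
    then show ?thesis by linarith
  qed
  have ABD: "A \<noteq> B" "A \<noteq> D" "B \<noteq> D"
    using not_spans_two[OF sp(1), of a b] not_spans_two[OF sp(1), of a c]
      not_spans_two[OF sp(3), of b c] sp(2,4,6) abc by auto
  have "card Q + 3 = (\<Sum>K\<in>Q. 1 + (if K \<in> {A, B, D} then 1 else 0))"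
  proof -
    have "(\<Sum>K\<in>Q. if K \<in> X then 1 else 0) = card (Q \<inter> X)" for X
      using finite_Q by (simp add: sum.If_cases)
    then have "(\<Sum>K\<in>Q. if K \<in> {A, B, D} then 1 else 0) = card (Q \<inter> {A, B, D})" .
    also have "Q \<inter> {A, B, D} = {A, B, D}" using sp by auto
    finally show ?thesis using ABD by (subst sum.distrib) simp
  qed
  also have "\<dots> \<le> (\<Sum>K\<in>Q. card (F K))"
  proof (rule sum_mono)
    fix K assume "K \<in> Q"
    then show "1 + (if K \<in> {A, B, D} then 1 else 0) \<le> card (F K)"
      using one[of K] two[OF sp(1,2)] two[OF sp(3,4)] two[OF sp(5,6)] by auto
  qed
  also have "\<dots> = card (\<Union>K\<in>Q. F K)"
    by (rule card_UN_disjoint[symmetric]) (auto simp: F_def finite_Q)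
  also have "\<dots> \<le> card (UNIV :: (3 \<Rightarrow> bool) set)" by (rule card_mono) auto
  also have "\<dots> = 8" by (simp add: card_fun)
  finally show False using six_le_card by simp
qed

lemma bound_three_directions:
  assumes abc: "distinct [a, b, c]"
    and sp: "A \<in> Q" "spans n a A" "B \<in> Q" "spans n b B" "D \<in> Q" "spans n c D"
  shows "2 * n\<^sup>2 + n \<le> card faces"
proof -
  obtain K d where K: "K \<in> Q" "0 < lo K d" "hi K d < n"
    using exists_inner_box[OF assms] by blast
  let ?v = "(lo K)(d := 0)"
  have "{lo K d - 1, hi K d - 1} \<subseteq> breaks d (lo K)"
    using lo_break[OF K(1) lo_in_cells[OF K(1)] K(2)]
      hi_break[OF K(1) lo_in_cells[OF K(1)] K(3)] by blast
  then have "card {lo K d - 1, hi K d - 1} \<le> card (breaks d (lo K))" by (intro card_mono) auto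
  moreover have "lo K d - 1 \<noteq> hi K d - 1" using K lo_less_hi[OF K(1), of d] by linarith
  ultimately have "?v \<in> multi_broken d"
    using cells_subset_cube[OF K(1)] lo_in_cells[OF K(1)] K(3)
    by (auto simp: multi_broken_def lines_def intro!: cube_cells_upd)
  then have "0 < card (multi_broken d)" using finite_multi_broken card_gt_0_iff by blast
  moreover have "d = a \<or> d = b \<or> d = c" using UNIV_distinct3[OF abc] by blast
  ultimately have multi: "1 \<le> card (multi_broken a) + card (multi_broken b) + card (multi_broken c)"
    by auto
  have "card (spanned a) + card (spanned b) + card (spanned c) + n
    \<le> card (shadow a b) * card (shadow a c) + card (shadow b c) * card (shadow b a)
      + card (shadow c a) * card (shadow c b) + n"
    using card_spanned_le[of a b c] card_spanned_le[of b c a] card_spanned_le[of c a b] abc by auto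
  also have "\<dots> \<le> n\<^sup>2 + 1"
    using card_shadow_pos sp card_shadows abc by (intro cyclic_product_bound) auto
  finally show ?thesis using faces_bound[OF abc] multi by linarith
qed

subsection \<open>Spanning boxes in two directions\<close>

lemma line_upd:
  assumes "v \<in> cube_cells" "spans n d (box_at v)" "t < n"
  shows "box_at (v(d := t)) = box_at v"
  using assms by (intro box_at_eq cells_spans_upd box_at)

lemma breaks_le_one:
  assumes "card (breaks d v) \<le> 1" "s \<in> breaks d v" "t \<in> breaks d v"
  shows "s = t"
  using assms card_le_Suc0_iff_eq[of "breaks d v"] by auto

lemma spanned_in_cube: "v \<in> spanned a \<Longrightarrow> v \<in> cube_cells"
  by (simp add: spanned_def lines_def)

text \<open>
  Let the layer at height \<open>k\<close> in direction \<open>c\<close> consist of lines spanned in direction \<open>a\<close>. If all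
  \<open>c\<close>-lines through a line spanned in direction \<open>b\<close> had at most one break, then on each of them the
  box \<open>A y\<close> of the full layer would directly adjoin the box \<open>B\<close> of the \<open>b\<close>-line. As the boxes
  \<open>A y\<close> span direction \<open>a\<close>, together they would fill one side of the plane at which \<open>B\<close> ends, and
  this would be a fault plane.
\<close>
lemma full_layer_meets:
  assumes abc: "distinct [a, b, c]"
    and k: "k < n" and full: "\<And>v. v \<in> cube_cells \<Longrightarrow> v c = k \<Longrightarrow> spans n a (box_at v)"
    and v: "v \<in> spanned b"
  shows "\<exists>y<n. v(b := y, c := 0) \<in> multi_broken c"
proof (rule ccontr)
  assume neg: "\<not> ?thesis"
  have vC: "v \<in> cube_cells" using v by (rule spanned_in_cube)
  then have n0: "0 < n" by (auto simp: cube_cells_def dest: spec[of _ b])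
  have one: "card (breaks c (v(b := y))) \<le> 1" if "y < n" for y
  proof -
    have "v(b := y, c := 0) \<in> lines c" using vC that n0 by (simp add: lines_def cube_cells_upd)
    then have "\<not> 2 \<le> card (breaks c (v(b := y)))" using neg that by (auto simp: multi_broken_def)
    then show ?thesis by simp
  qed
  define B where "B = box_at v"
  have B: "B \<in> Q" "spans n b B" "v \<in> cells B"
    using v box_at[OF vC] by (auto simp: B_def spanned_def)
  have vyB: "v(b := y) \<in> cells B" if "y < n" for y
    using cells_spans_upd[OF B(3,2) that] .
  define A where "A y = box_at (v(b := y, c := k))" for y
  have AC: "v(b := y, c := k) \<in> cube_cells" if "y < n" for y using vC that k by (simp add: cube_cells_upd)
  have A: "A y \<in> Q" "spans n a (A y)" "v(b := y, c := k) \<in> cells (A y)" if "y < n" for y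
    using box_at[OF AC[OF that]] full[OF AC[OF that]] by (auto simp: A_def)
  have AB: "A y \<noteq> B" if "y < n" for y
    using not_spans_two[OF B(1), of a b] A(2)[OF that] B(2) abc by auto
  have Ab: "lo (A y) b \<le> y" "y < hi (A y) b" "lo (A y) c \<le> k" "k < hi (A y) c" if "y < n" for y
    using A(3)[OF that] abc unfolding cells_def mem_Collect_eq forall_distinct3[OF abc] by auto
  have Ain: "w \<in> cells (A (w b))" if "w \<in> cube_cells" "lo (A (w b)) c \<le> w c" "w c < hi (A (w b)) c" for w
  proof -
    have "w b < n" "w a < n" using that(1) by (auto simp: cube_cells_def)
    then show ?thesis
      using that(2,3) Ab(1,2)[of "w b"] A(2)[of "w b"]
      unfolding cells_def mem_Collect_eq forall_distinct3[OF abc] by (simp add: spans_def)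
  qed
  have Bc: "lo B c \<le> v c" "v c < hi B c" using B(3) by (auto simp: cells_def)
  have kB: "\<not> (lo B c \<le> k \<and> k < hi B c)"
  proof
    assume "lo B c \<le> k \<and> k < hi B c"
    then have "v(b := 0, c := k) \<in> cells B" by (intro cells_upd[OF vyB[OF n0]]) auto
    then show False using AB[OF n0] box_unique[OF A(1)[OF n0] B(1) A(3)[OF n0]] by blast
  qed
  have vA: "\<not> (lo (A y) c \<le> v c \<and> v c < hi (A y) c)" if y: "y < n" for y
  proof
    assume "lo (A y) c \<le> v c \<and> v c < hi (A y) c"
    then have "(v(b := y, c := k))(c := v c) \<in> cells (A y)" by (intro cells_upd[OF A(3)[OF y]]) auto
    moreover have "(v(b := y, c := k))(c := v c) = v(b := y)" using abc by auto
    ultimately have "v(b := y) \<in> cells (A y)" by simp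
    then show False using AB[OF y] box_unique[OF A(1)[OF y] B(1) _ vyB[OF y]] by blast
  qed
  have brA: "0 < lo (A y) c \<Longrightarrow> lo (A y) c - 1 \<in> breaks c (v(b := y))"
    "hi (A y) c < n \<Longrightarrow> hi (A y) c - 1 \<in> breaks c (v(b := y))" if "y < n" for y
    using lo_break[OF A(1,3)[OF that], of c] hi_break[OF A(1,3)[OF that], of c] by auto
  have brB: "0 < lo B c \<Longrightarrow> lo B c - 1 \<in> breaks c (v(b := y))"
    "hi B c < n \<Longrightarrow> hi B c - 1 \<in> breaks c (v(b := y))" if "y < n" for y
    using lo_break[OF B(1) vyB[OF that], of c] hi_break[OF B(1) vyB[OF that], of c] by auto
  note br1 = breaks_le_one[OF one]
  have vcn: "v c < n" using vC by (simp add: cube_cells_def)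
  show False
  proof (cases "k < v c")
    case True
    have kB': "k < lo B c" using kB Bc True by linarith
    define q where "q = lo B c"
    have q: "0 < q" "q < n" using kB' Bc vcn by (auto simp: q_def)
    have hiA: "lo (A y) c = 0" "hi (A y) c = q" if y: "y < n" for y
    proof -
      have h: "hi (A y) c < n" using vA[OF y] Ab[OF y] True vcn by linarith
      have e: "hi (A y) c - 1 = lo B c - 1"
        using br1[OF y brA(2)[OF y h] brB(1)[OF y]] q(1) by (simp add: q_def)
      show "hi (A y) c = q" using e Ab[OF y] q by (simp add: q_def)
      show "lo (A y) c = 0"
      proof (rule ccontr)
        assume l: "lo (A y) c \<noteq> 0"
        have "lo (A y) c - 1 = hi (A y) c - 1" using br1[OF y brA(1)[OF y] brA(2)[OF y h]] l by simp
        then show False using Ab[OF y] l by linarith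
      qed
    qed
    obtain K where K: "K \<in> Q" "lo K c < q" "q < hi K c" using crossed[OF q] by blast
    define w where "w = (lo K)(c := q - 1)"
    have wK: "w \<in> cells K" unfolding w_def using K lo_in_cells[OF K(1)] by (intro cells_upd) auto
    then have wC: "w \<in> cube_cells" using cells_subset_cube[OF K(1)] by blast
    then have wn: "w b < n" by (simp add: cube_cells_def)
    have "w \<in> cells (A (w b))" using hiA[OF wn] q by (intro Ain wC) (auto simp: w_def)
    then have "A (w b) = K" using box_unique[OF A(1)[OF wn] K(1) _ wK] by blast
    then show False using hiA[OF wn] K by simp
  next
    case False
    have kB': "hi B c \<le> k" using kB Bc False by linarith
    define q where "q = hi B c"
    have q: "0 < q" "q < n" using kB' Bc k by (auto simp: q_def)
    have loA: "hi (A y) c = n" "lo (A y) c = q" if y: "y < n" for y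
    proof -
      have l: "0 < lo (A y) c" using vA[OF y] Ab[OF y] False by linarith
      have e: "lo (A y) c - 1 = hi B c - 1"
        using br1[OF y brA(1)[OF y l] brB(2)[OF y]] q(2) by (simp add: q_def)
      show "lo (A y) c = q" using e l q by (simp add: q_def)
      show "hi (A y) c = n"
      proof (rule ccontr)
        assume h: "hi (A y) c \<noteq> n"
        then have "hi (A y) c < n" using hi_le[OF A(1)[OF y], of c] by linarith
        then have "lo (A y) c - 1 = hi (A y) c - 1" using br1[OF y brA(1)[OF y l] brA(2)[OF y]] by simp
        then show False using Ab[OF y] l by linarith
      qed
    qed
    obtain K where K: "K \<in> Q" "lo K c < q" "q < hi K c" using crossed[OF q] by blast
    define w where "w = (lo K)(c := q)"
    have wK: "w \<in> cells K" unfolding w_def using K lo_in_cells[OF K(1)] by (intro cells_upd) auto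
    then have wC: "w \<in> cube_cells" using cells_subset_cube[OF K(1)] by blast
    then have wn: "w b < n" by (simp add: cube_cells_def)
    have "w \<in> cells (A (w b))" using loA[OF wn] q by (intro Ain wC) (auto simp: w_def)
    then have "A (w b) = K" using box_unique[OF A(1)[OF wn] K(1) _ wK] by blast
    then show False using loA[OF wn] K by simp
  qed
qed

text \<open>The multiply broken lines of \<open>full_layer_meets\<close> differ for different spanned lines of a layer.\<close>
lemma full_layer_bound:
  assumes abc: "distinct [a, b, c]"
    and k: "k < n" and full: "\<And>v. v \<in> cube_cells \<Longrightarrow> v c = k \<Longrightarrow> spans n a (box_at v)"
  shows "card {v \<in> spanned b. v c = j} \<le> card (multi_broken c)"
proof -
  have "\<forall>v\<in>spanned b. \<exists>y. v(b := y, c := 0) \<in> multi_broken c" using full_layer_meets[OF assms] by blast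
  then obtain f where f: "\<And>v. v \<in> spanned b \<Longrightarrow> v(b := f v, c := 0) \<in> multi_broken c" by metis
  show ?thesis
  proof (rule card_inj_on_le)
    show "inj_on (\<lambda>v. v(b := f v, c := 0)) {v \<in> spanned b. v c = j}"
    proof (rule inj_onI)
      fix v w assume vw: "v \<in> {v \<in> spanned b. v c = j}" "w \<in> {v \<in> spanned b. v c = j}"
        and eq: "v(b := f v, c := 0) = w(b := f w, c := 0)"
      have "v a = w a" using fun_cong[OF eq, of a] abc by simp
      then show "v = w" using vw abc by (intro lines_eqI[of b a c]) (auto simp: spanned_def)
    qed
    show "(\<lambda>v. v(b := f v, c := 0)) ` {v \<in> spanned b. v c = j} \<subseteq> multi_broken c" using f by auto
  qed simp
qed

lemma card_lines_layer:
  assumes abc: "distinct [a, b, c]"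
  shows "card {v \<in> lines a. v c = k} \<le> n"
proof -
  have "card {v \<in> lines a. v c = k} \<le> card {..<n}"
  proof (rule card_inj_on_le[of "\<lambda>v. v b"])
    show "inj_on (\<lambda>v. v b) {v \<in> lines a. v c = k}"
      by (rule inj_onI) (use lines_eqI[OF abc] in auto)
  qed (auto simp: lines_def cube_cells_def)
  then show ?thesis by simp
qed

lemma card_spanned_layer:
  assumes abc: "distinct [a, b, c]"
  shows "card {v \<in> spanned a. v c = k} \<le> n"
proof -
  have "card {v \<in> spanned a. v c = k} \<le> card {v \<in> lines a. v c = k}"
    by (intro card_mono) (auto simp: spanned_def)
  then show ?thesis using card_lines_layer[OF abc] le_trans by blast
qed

text \<open>Lines of the same layer that point in different directions intersect, so their boxes
  coincide if both are spanned.\<close>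
lemma layer_exclusive:
  assumes abc: "distinct [a, b, c]" and v: "v \<in> spanned a" and w: "w \<in> spanned b" and "v c = w c"
  shows False
proof -
  let ?u = "v(a := w a)"
  have vC: "v \<in> cube_cells" and wC: "w \<in> cube_cells" using v w spanned_in_cube by auto
  have "w a < n" "v b < n" using vC wC by (auto simp: cube_cells_def)
  have "?u \<in> cells (box_at v)"
    using v in_box_at[OF vC] \<open>w a < n\<close> by (intro cells_spans_upd) (auto simp: spanned_def)
  moreover have "?u = w(b := v b)"
    unfolding fun_eq_iff forall_distinct3[OF abc] using abc assms(4) by auto
  moreover have "w(b := v b) \<in> cells (box_at w)"
    using w in_box_at[OF wC] \<open>v b < n\<close> by (intro cells_spans_upd) (auto simp: spanned_def)
  ultimately have "box_at v = box_at w"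
    using box_unique[OF box_at_in[OF vC] box_at_in[OF wC]] by metis
  then show False
    using not_spans_two[OF box_at_in[OF vC], of a b] v w abc by (auto simp: spanned_def)
qed

lemma full_layerD:
  assumes abc: "distinct [a, b, c]" and full: "card {v \<in> spanned a. v c = k} = n"
    and v: "v \<in> cube_cells" "v c = k"
  shows "spans n a (box_at v)"
proof -
  have "{v \<in> spanned a. v c = k} = {v \<in> lines a. v c = k}"
    using full card_lines_layer[OF abc] by (intro card_seteq) (auto simp: spanned_def)
  moreover have "0 < n" using v(1) by (auto simp: cube_cells_def dest: spec[of _ a])
  then have "v(a := 0) \<in> {v \<in> lines a. v c = k}" using v abc by (auto simp: lines_def cube_cells_upd)
  ultimately have spn: "v(a := 0) \<in> spanned a" by blast
  then have "spans n a (box_at (v(a := 0)))" by (simp add: spanned_def)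
  moreover have "v a < n" using v by (simp add: cube_cells_def)
  ultimately have "box_at ((v(a := 0))(a := v a)) = box_at (v(a := 0))"
    using line_upd[OF spanned_in_cube[OF spn]] by blast
  then show ?thesis using \<open>spans n a (box_at (v(a := 0)))\<close> by simp
qed

lemma layer_empty:
  assumes abc: "distinct [a, b, c]"
  shows "card {v \<in> spanned a. v c = k} = 0 \<or> card {v \<in> spanned b. v c = k} = 0"
proof (rule ccontr)
  assume neg: "\<not> ?thesis"
  then have "{v \<in> spanned a. v c = k} \<noteq> {}" "{v \<in> spanned b. v c = k} \<noteq> {}" by (metis card.empty)+
  then obtain v w where "v \<in> spanned a" "w \<in> spanned b" "v c = k" "w c = k" by auto
  then show False using layer_exclusive[OF abc, of v w] by simp
qed

lemma layer_le:
  assumes abc: "distinct [a, b, c]"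
  shows "card {v \<in> spanned a. v c = k} + card {v \<in> spanned b. v c = k} \<le> n"
proof -
  have bac: "distinct [b, a, c]" using abc by auto
  show ?thesis
    using layer_empty[OF abc, of k] card_spanned_layer[OF abc, of k] card_spanned_layer[OF bac, of k]
    by linarith
qed

lemma card_spanned_layers: "card (spanned a) = (\<Sum>k<n. card {v \<in> spanned a. v c = k})"
  by (rule card_by_value) (simp, simp add: spanned_def lines_def cube_cells_def)

text \<open>
  Apart from the layer \<open>j\<close>, which meets a box spanning \<open>b\<close>, each layer contains at most \<open>n\<close>
  spanned lines; those in the layer \<open>j\<close> are compensated by multiply broken lines.
\<close>
lemma two_direction_deficit_full:
  assumes abc: "distinct [a, b, c]" and B: "B \<in> Q" "spans n b B"
    and k: "k < n" and full: "card {v \<in> spanned a. v c = k} = n"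
  shows "card (spanned a) + card (spanned b) + n \<le> n\<^sup>2 + card (multi_broken c)"
proof -
  define g where "g k = card {v \<in> spanned a. v c = k} + card {v \<in> spanned b. v c = k}" for k
  have g: "g k \<le> n" for k using layer_le[OF abc] by (simp add: g_def)
  have sum: "card (spanned a) + card (spanned b) = (\<Sum>k<n. g k)"
    unfolding g_def sum.distrib using card_spanned_layers[of a c] card_spanned_layers[of b c] by simp
  define j where "j = lo B c"
  have jn: "j < n" using lo_less_hi[OF B(1), of c] hi_le[OF B(1), of c] by (simp add: j_def)
  let ?v = "(lo B)(b := 0)"
  have n0: "0 < n" using jn by simp
  have "?v \<in> cells B" using B n0 by (intro cells_spans_upd lo_in_cells)
  then have "?v \<in> cube_cells" "box_at ?v = B" using cells_subset_cube[OF B(1)] box_at_eq[OF B(1)] by auto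
  then have vS: "?v \<in> spanned b" using B by (simp add: spanned_def lines_def)
  have "card {v \<in> spanned a. v c = j} = 0"
  proof -
    have "?v \<in> {v \<in> spanned b. v c = j}" using vS abc by (auto simp: j_def)
    then have "card {v \<in> spanned b. v c = j} \<noteq> 0" by auto
    then show ?thesis using layer_empty[OF abc, of j] by linarith
  qed
  then have "g j \<le> card (multi_broken c)"
    using full_layer_bound[OF abc k full_layerD[OF abc full], where j = j] unfolding g_def by linarith
  moreover have "(\<Sum>k<n. g k) + n \<le> n\<^sup>2 + g j" using g jn by (intro sum_one_exception)
  ultimately show ?thesis using sum by linarith
qed

lemma bound_two_directions:
  assumes abc: "distinct [a, b, c]"
    and A: "A \<in> Q" "spans n a A" and B: "B \<in> Q" "spans n b B"
    and no: "\<And>K. K \<in> Q \<Longrightarrow> \<not> spans n c K"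
  shows "2 * n\<^sup>2 + n \<le> card faces"
proof -
  have bac: "distinct [b, a, c]" using abc by auto
  have "card (spanned a) + card (spanned b) + n \<le> n\<^sup>2 + card (multi_broken c)"
  proof (cases "\<exists>k<n. card {v \<in> spanned a. v c = k} = n \<or> card {v \<in> spanned b. v c = k} = n")
    case True
    then show ?thesis
      using two_direction_deficit_full[OF abc B] two_direction_deficit_full[OF bac A]
      by (auto simp: add.commute)
  next
    case False
    have "card {v \<in> spanned a. v c = k} + card {v \<in> spanned b. v c = k} \<le> n - 1" if k: "k < n" for k
    proof -
      have "card {v \<in> spanned a. v c = k} \<noteq> n" "card {v \<in> spanned b. v c = k} \<noteq> n" using False k by blast+
      then show ?thesis
        using layer_empty[OF abc, of k] card_spanned_layer[OF abc, of k] card_spanned_layer[OF bac, of k]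
        by linarith
    qed
    then have "(\<Sum>k<n. card {v \<in> spanned a. v c = k} + card {v \<in> spanned b. v c = k}) \<le> n * (n - 1)"
      using sum_bounded_above[of "{..<n}"
          "\<lambda>k. card {v \<in> spanned a. v c = k} + card {v \<in> spanned b. v c = k}" "n - 1"] by simp
    moreover have "card (spanned a) + card (spanned b)
      = (\<Sum>k<n. card {v \<in> spanned a. v c = k} + card {v \<in> spanned b. v c = k})"
      unfolding sum.distrib using card_spanned_layers[of a c] card_spanned_layers[of b c] by simp
    moreover have "n * (n - 1) + n = n\<^sup>2" by (cases n) (auto simp: power2_eq_square)
    ultimately show ?thesis by linarith
  qed
  moreover have "card (spanned c) = 0" using spanned_empty[OF no] by simp
  ultimately show ?thesis using faces_bound[OF abc] by linarith
qed

subsection \<open>At most one direction with spanning boxes\<close>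

text \<open>
  The end of the first box on the line through \<open>v\<close> in direction \<open>d\<close>. If no box spans \<open>d\<close> and
  the line has at most one break, then it meets exactly two boxes, which are separated by this
  position.
\<close>
definition cut_at :: "3 \<Rightarrow> cell \<Rightarrow> nat" where
  "cut_at d v = hi (box_at (v(d := 0))) d"

lemma cut_upd [simp]: "cut_at d (v(d := t)) = cut_at d v"
  by (simp add: cut_at_def)

lemma cut_line:
  assumes v: "v \<in> cube_cells" and no: "\<And>K. K \<in> Q \<Longrightarrow> \<not> spans n d K" and br: "card (breaks d v) \<le> 1"
  shows cut_pos: "0 < cut_at d v" and cut_less: "cut_at d v < n"
    and below_cut: "v d < cut_at d v \<Longrightarrow> lo (box_at v) d = 0 \<and> hi (box_at v) d = cut_at d v"
    and above_cut: "cut_at d v \<le> v d \<Longrightarrow> lo (box_at v) d = cut_at d v \<and> hi (box_at v) d = n"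
proof -
  have n0: "0 < n" using v by (auto simp: cube_cells_def dest: spec[of _ d])
  define A where "A = box_at (v(d := 0))"
  have AC: "v(d := 0) \<in> cube_cells" using v n0 by (rule cube_cells_upd)
  have A: "A \<in> Q" "v(d := 0) \<in> cells A" using box_at[OF AC] by (simp_all add: A_def)
  have loA: "lo A d = 0" using A(2) by (auto simp: cells_def dest: spec[of _ d])
  then have hiA: "hi A d < n" using no[OF A(1)] hi_le[OF A(1), of d] by (simp add: spans_def)
  have brA: "hi A d - 1 \<in> breaks d v" using hi_break[OF A hiA] by simp
  have cA: "cut_at d v = hi A d" by (simp add: cut_at_def A_def)
  show pos: "0 < cut_at d v" using lo_less_hi[OF A(1), of d] cA by simp
  show "cut_at d v < n" using hiA cA by simp
  define K where "K = box_at v"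
  have K: "K \<in> Q" "v \<in> cells K" using box_at[OF v] by (simp_all add: K_def)
  have vK: "lo K d \<le> v d" "v d < hi K d" using K(2) by (auto simp: cells_def)
  have "(lo K d = 0 \<and> hi K d = cut_at d v) \<or> (lo K d = cut_at d v \<and> hi K d = n)"
  proof (cases "lo K d = 0")
    case True
    then have "hi K d < n" using no[OF K(1)] hi_le[OF K(1), of d] by (simp add: spans_def)
    then have "hi K d - 1 = hi A d - 1" using breaks_le_one[OF br hi_break[OF K] brA] by simp
    then show ?thesis using True cA pos vK by linarith
  next
    case False
    then have l: "lo K d - 1 = hi A d - 1" using breaks_le_one[OF br lo_break[OF K] brA] by simp
    have "hi K d = n"
    proof (rule ccontr)
      assume "hi K d \<noteq> n"
      then have "hi K d < n" using hi_le[OF K(1), of d] by simp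
      then have "hi K d - 1 = hi A d - 1" using breaks_le_one[OF br hi_break[OF K] brA] by simp
      then show False using l False lo_less_hi[OF K(1), of d] by linarith
    qed
    then show ?thesis using l False cA pos by linarith
  qed
  then show "v d < cut_at d v \<Longrightarrow> lo (box_at v) d = 0 \<and> hi (box_at v) d = cut_at d v"
    "cut_at d v \<le> v d \<Longrightarrow> lo (box_at v) d = cut_at d v \<and> hi (box_at v) d = n"
    using vK unfolding K_def by linarith+
qed

lemma cut_same_box:
  assumes v: "v \<in> cube_cells" "card (breaks d v) \<le> 1" and w: "w \<in> cube_cells" "card (breaks d w) \<le> 1"
    and no: "\<And>K. K \<in> Q \<Longrightarrow> \<not> spans n d K" and same: "box_at v = box_at w"
  shows "cut_at d v = cut_at d w"
  using cut_line[OF v(1) no v(2)] cut_line[OF w(1) no w(2)] unfolding same by linarith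

text \<open>
  As the point moves along a line in direction \<open>c\<close> that meets just two boxes, the cut in direction
  \<open>b\<close> takes at most two values: that at the first and that at the last cell of the line, changing
  where the line passes to the other box.
\<close>
lemma cut_along_line:
  assumes no: "\<And>K. K \<in> Q \<Longrightarrow> \<not> spans n b K" "\<And>K. K \<in> Q \<Longrightarrow> \<not> spans n c K"
    and u: "u \<in> cube_cells" and z: "z < n"
    and br: "card (breaks c u) \<le> 1" "\<And>t. t < n \<Longrightarrow> card (breaks b (u(c := t))) \<le> 1"
  shows "cut_at b (u(c := z)) = (if z < cut_at c u then cut_at b (u(c := 0)) else cut_at b (u(c := n - 1)))"
proof -
  have n0: "0 < n" using z by simp
  have uz: "u(c := t) \<in> cube_cells" if "t < n" for t using u that by (rule cube_cells_upd)
  have brz: "card (breaks c (u(c := z))) \<le> 1" using br(1) by simp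
  note cl = cut_line[OF uz[OF z] no(2) brz, simplified]
  have same: "box_at (u(c := z)) = box_at (u(c := t))"
    if t: "t < n" "lo (box_at (u(c := z))) c \<le> t" "t < hi (box_at (u(c := z))) c" for t
  proof -
    have "(u(c := z))(c := t) \<in> cells (box_at (u(c := z)))"
      using t by (intro cells_upd in_box_at[OF uz[OF z]]) auto
    then show ?thesis using box_at_eq[OF box_at_in[OF uz[OF z]]] by simp
  qed
  have eq: "cut_at b (u(c := z)) = cut_at b (u(c := t))"
    if t: "t < n" "lo (box_at (u(c := z))) c \<le> t" "t < hi (box_at (u(c := z))) c" for t
    by (rule cut_same_box[OF uz[OF z] br(2)[OF z] uz[OF t(1)] br(2)[OF t(1)] no(1) same[OF t]])
  show ?thesis
  proof (cases "z < cut_at c u")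
    case True
    then show ?thesis using eq[of 0] cl n0 by simp
  next
    case False
    then show ?thesis using eq[of "n - 1"] cl n0 by simp
  qed
qed

text \<open>
  A square slice all of whose lines in both directions meet exactly two boxes has a straight cut.
  Otherwise the \<open>b\<close>-cuts on the first and last \<open>b\<close>-line differ, and so do the \<open>c\<close>-cuts on the first
  and last \<open>c\<close>-line. But along the first \<open>c\<close>-line the \<open>b\<close>-cut changes at the first of these
  \<open>c\<close>-cuts, and along the last \<open>c\<close>-line at the second of them, while the \<open>b\<close>-cut of a \<open>b\<close>-line does
  not depend on where the line is entered.
\<close>
lemma slice_fault:
  assumes abc: "distinct [a, b, c]" and k: "k < n"
    and no: "\<And>K. K \<in> Q \<Longrightarrow> \<not> spans n b K" "\<And>K. K \<in> Q \<Longrightarrow> \<not> spans n c K"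
    and br: "\<And>v. v \<in> cube_cells \<Longrightarrow> v a = k \<Longrightarrow> card (breaks b v) \<le> 1"
      "\<And>v. v \<in> cube_cells \<Longrightarrow> v a = k \<Longrightarrow> card (breaks c v) \<le> 1"
  shows "(\<exists>p. \<forall>v\<in>cube_cells. v a = k \<longrightarrow> cut_at b v = p) \<or>
    (\<exists>p. \<forall>v\<in>cube_cells. v a = k \<longrightarrow> cut_at c v = p)"
proof -
  have n0: "0 < n" using k by simp
  \<comment> \<open>The first corner of the slice; \<open>r\<close> below is its other corner on the first \<open>b\<close>-line.\<close>
  define o0 :: cell where "o0 = (\<lambda>_. 0)(a := k)"
  have o0: "o0 \<in> cube_cells" "o0 a = k" "o0 b = 0" "o0 c = 0"
    using k n0 abc by (auto simp: o0_def cube_cells_def)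
  have sl: "u(d := t) \<in> cube_cells" "(u(d := t)) a = k" if "u \<in> cube_cells" "u a = k" "t < n" "d \<noteq> a" for u d t
    using that by (auto intro: cube_cells_upd)
  have ne: "a \<noteq> b" "b \<noteq> a" "a \<noteq> c" "c \<noteq> a" "b \<noteq> c" "c \<noteq> b" using abc by auto
  have B: "cut_at b (u(c := z)) = (if z < cut_at c u then cut_at b (u(c := 0)) else cut_at b (u(c := n - 1)))"
    if u: "u \<in> cube_cells" "u a = k" and z: "z < n" for u z
  proof -
    have sb: "card (breaks b (u(c := t))) \<le> 1" if "t < n" for t using br(1) sl[OF u that ne(4)] by blast
    show ?thesis by (rule cut_along_line[OF no u(1) z br(2)[OF u] sb])
  qed
  have G: "cut_at c (u(b := y)) = (if y < cut_at b u then cut_at c (u(b := 0)) else cut_at c (u(b := n - 1)))"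
    if u: "u \<in> cube_cells" "u a = k" and y: "y < n" for u y
  proof -
    have sb: "card (breaks c (u(b := t))) \<le> 1" if "t < n" for t using br(2) sl[OF u that ne(2)] by blast
    show ?thesis by (rule cut_along_line[OF no(2,1) u(1) y br(1)[OF u] sb])
  qed
  have oc: "o0(c := 0) = o0" and ob: "o0(b := 0) = o0" using o0 by auto
  define r where "r = o0(b := n - 1)"
  have r: "r \<in> cube_cells" "r a = k" unfolding r_def using sl[OF o0(1,2) _ ne(2)] n0 by auto
  have rb: "cut_at b (r(c := z)) = cut_at b (o0(c := z))" for z
    using cut_upd[of b "o0(c := z)" "n - 1"] ne by (simp add: r_def fun_upd_twist)
  have corner: "cut_at b o0 = cut_at b (o0(c := n - 1)) \<or> cut_at c o0 = cut_at c r"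
  proof (rule ccontr)
    assume neg: "\<not> ?thesis"
    define z where "z = min (cut_at c o0) (cut_at c r)"
    \<comment> \<open>The two \<open>c\<close>-lines lie on different sides of their cuts on the \<open>b\<close>-line at height \<open>z\<close>.\<close>
    have zn: "z < n" using cut_less[OF o0(1) no(2) br(2)[OF o0(1,2)]] by (simp add: z_def)
    have "(if z < cut_at c o0 then cut_at b o0 else cut_at b (o0(c := n - 1)))
        = (if z < cut_at c r then cut_at b o0 else cut_at b (o0(c := n - 1)))"
      using trans[OF B[OF o0(1,2) zn, symmetric] trans[OF rb[of z, symmetric] B[OF r zn]]]
      unfolding rb oc .
    moreover have "(z < cut_at c o0) \<noteq> (z < cut_at c r)" using neg by (auto simp: z_def)
    ultimately show False using neg by (auto split: if_splits)
  qed
  have vb: "cut_at b v = cut_at b (o0(c := v c))" and vc: "cut_at c v = cut_at c (o0(b := v b))"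
    if "v a = k" for v
  proof -
    have "v(b := 0) = o0(c := v c)" "v(c := 0) = o0(b := v b)"
      unfolding fun_eq_iff forall_distinct3[OF abc] using ne o0 that by auto
    then show "cut_at b v = cut_at b (o0(c := v c))" "cut_at c v = cut_at c (o0(b := v b))"
      using cut_upd[of b v 0] cut_upd[of c v 0] by metis+
  qed
  show ?thesis
  proof (cases "cut_at b o0 = cut_at b (o0(c := n - 1))")
    case True
    have "cut_at b v = cut_at b o0" if v: "v \<in> cube_cells" "v a = k" for v
    proof -
      have "v c < n" using v(1) by (simp add: cube_cells_def)
      from B[OF o0(1,2) this] show ?thesis using vb[of v, OF v(2)] True oc by simp
    qed
    then show ?thesis by blast
  next
    case False
    then have e: "cut_at c o0 = cut_at c r" using corner by blast
    have "cut_at c v = cut_at c o0" if v: "v \<in> cube_cells" "v a = k" for v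
    proof -
      have "v b < n" using v(1) by (simp add: cube_cells_def)
      from G[OF o0(1,2) this] show ?thesis using vc[of v, OF v(2)] e ob by (simp add: r_def)
    qed
    then show ?thesis by blast
  qed
qed

text \<open>
  Let the slice at \<open>a\<close>-coordinate \<open>k\<close> have a straight cut at \<open>b\<close>-coordinate \<open>p\<close>. Some box \<open>K\<close> crosses the
  plane of this cut. Consider a layer in direction \<open>c\<close> that meets \<open>K\<close>. If a line of this layer in
  direction \<open>a\<close> were spanned, then its box would end at the cut, and as it reaches through all
  slices it would overlap with \<open>K\<close>. So no \<open>a\<close>-line of the layer is spanned.
\<close>
lemma straight_cut_bound:
  assumes abc: "distinct [a, b, c]" and k: "k < n" and p: "0 < p" "p < n"
    and cut_at: "\<And>v. v \<in> cube_cells \<Longrightarrow> v a = k \<Longrightarrow> hi (box_at v) b = p \<or> lo (box_at v) b = p"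
  shows "card (spanned a) + n \<le> n\<^sup>2"
proof -
  obtain K where K: "K \<in> Q" "lo K b < p" "p < hi K b" using crossed[OF p] by blast
  define z where "z = lo K c"
  have zn: "z < n" using lo_less_hi[OF K(1), of c] hi_le[OF K(1), of c] by (simp add: z_def)
  have ns: False if v: "v \<in> spanned a" "v c = z" for v
  proof -
    have vC: "v \<in> cube_cells" using v(1) by (rule spanned_in_cube)
    define R where "R = box_at v"
    have sp: "spans n a R" using v(1) by (simp add: R_def spanned_def)
    have Rk: "box_at (v(a := k)) = R" unfolding R_def using line_upd[OF vC _ k] v(1) by (simp add: spanned_def)
    have RQ: "R \<in> Q" unfolding R_def using vC by (rule box_at_in)
    have vR: "v \<in> cells R" unfolding R_def using vC by (rule in_box_at)
    then have R: "lo R b \<le> v b" "v b < hi R b" "lo R c \<le> z" "z < hi R c"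
      using v(2) by (auto simp: cells_def)
    have "hi R b = p \<or> lo R b = p" using cut_at[of "v(a := k)"] vC k by (simp add: Rk cube_cells_upd)
    \<comment> \<open>\<open>K\<close> contains cells on both sides of the cut, so some \<open>b\<close>-coordinate is common to \<open>R\<close> and \<open>K\<close>.\<close>
    then obtain t where t: "lo R b \<le> t" "t < hi R b" "lo K b \<le> t" "t < hi K b"
    proof
      assume "hi R b = p" then show ?thesis using that[of "p - 1"] R K p by simp
    next
      assume "lo R b = p" then show ?thesis using that[of p] R K p by simp
    qed
    let ?w = "(lo K)(b := t)"
    have wK: "?w \<in> cells K" using t by (intro cells_upd lo_in_cells K(1))
    then have "?w \<in> cube_cells" using cells_subset_cube[OF K(1)] by blast
    then have "?w a < n" unfolding cube_cells_def by blast
    then have "?w \<in> cells R"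
      unfolding cells_def mem_Collect_eq forall_distinct3[OF abc]
      using sp t(1,2) R(3,4) abc by (auto simp: spans_def z_def)
    then have "R = K" using wK box_unique[OF RQ K(1)] by blast
    then show False using \<open>hi R b = p \<or> lo R b = p\<close> K by auto
  qed
  then have "{v \<in> spanned a. v c = z} = {}" by blast
  then have "card {v \<in> spanned a. v c = z} = 0" by simp
  then show ?thesis
    using sum_one_exception[of "\<lambda>k. card {v \<in> spanned a. v c = k}", OF card_spanned_layer[OF abc] zn]
    unfolding card_spanned_layers[of a c] by linarith
qed

lemma bound_one_direction:
  assumes abc: "distinct [a, b, c]"
    and no: "\<And>K. K \<in> Q \<Longrightarrow> \<not> spans n b K" "\<And>K. K \<in> Q \<Longrightarrow> \<not> spans n c K"
  shows "2 * n\<^sup>2 + n \<le> card faces"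
proof -
  have "card (spanned a) + n \<le> n\<^sup>2 + card (multi_broken b) + card (multi_broken c)"
  proof (cases "\<forall>k<n. \<exists>v\<in>multi_broken b \<union> multi_broken c. v a = k")
    case True
    then have "{..<n} \<subseteq> (\<lambda>v. v a) ` (multi_broken b \<union> multi_broken c)" by blast
    then have "card {..<n} \<le> card (multi_broken b \<union> multi_broken c)" by (intro surj_card_le) auto
    also have "\<dots> \<le> card (multi_broken b) + card (multi_broken c)" by (rule card_Un_le)
    finally have "n \<le> card (multi_broken b) + card (multi_broken c)" by simp
    moreover have "card (spanned a) \<le> card (lines a)" by (intro card_mono) (auto simp: spanned_def)
    ultimately show ?thesis using card_lines[of a] by simp
  next
    case False
    then obtain k where k: "k < n"
      and empty: "\<And>v. v \<in> multi_broken b \<union> multi_broken c \<Longrightarrow> v a \<noteq> k" by blast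
    have n0: "0 < n" using k by simp
    have br: "card (breaks d v) \<le> 1" if "v \<in> cube_cells" "v a = k" "d \<in> {b, c}" for d v
    proof (rule ccontr)
      assume "\<not> card (breaks d v) \<le> 1"
      then have "v(d := 0) \<in> multi_broken d"
        using that n0 by (simp add: multi_broken_def lines_def cube_cells_upd)
      moreover have "(v(d := 0)) a = k" using that abc by auto
      ultimately show False using empty that(3) by blast
    qed
    have brb: "card (breaks b v) \<le> 1" and brc: "card (breaks c v) \<le> 1" if "v \<in> cube_cells" "v a = k" for v
      using br[OF that] by simp_all
    have acb: "distinct [a, c, b]" using abc by auto
    have use: "card (spanned a) + n \<le> n\<^sup>2"
      if abc': "distinct [a, b', c']" and no': "\<And>K. K \<in> Q \<Longrightarrow> \<not> spans n b' K"
        and br': "\<And>v. v \<in> cube_cells \<Longrightarrow> v a = k \<Longrightarrow> card (breaks b' v) \<le> 1"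
        and p: "\<forall>v\<in>cube_cells. v a = k \<longrightarrow> cut_at b' v = p" for b' c' p
    proof -
      define u :: cell where "u = (\<lambda>_. 0)(a := k)"
      have u: "u \<in> cube_cells" "u a = k" using k n0 by (auto simp: cube_cells_def u_def)
      then have "cut_at b' u = p" using p by blast
      then have "0 < p" "p < n" using cut_line(1,2)[OF u(1) no' br'[OF u]] by auto
      then show ?thesis
      proof (rule straight_cut_bound[OF abc' k])
        fix v assume v: "v \<in> cube_cells" "v a = k"
        then have "cut_at b' v = p" using p by blast
        then show "hi (box_at v) b' = p \<or> lo (box_at v) b' = p"
          using cut_line(3,4)[OF v(1) no' br'[OF v]] by linarith
      qed
    qed
    from slice_fault[OF abc k no brb brc] have "card (spanned a) + n \<le> n\<^sup>2"
      using use[OF abc no(1) brb] use[OF acb no(2) brc] by blast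
    then show ?thesis by simp
  qed
  moreover have "card (spanned b) = 0" "card (spanned c) = 0"
    using spanned_empty[OF no(1)] spanned_empty[OF no(2)] by simp_all
  ultimately show ?thesis using faces_bound[OF abc] by linarith
qed

theorem card_faces_ge: "2 * n\<^sup>2 + n \<le> card faces"
proof -
  define H where "H d \<longleftrightarrow> (\<exists>K\<in>Q. spans n d K)" for d
  have three: ?thesis if "distinct [a, b, c]" "H a" "H b" "H c" for a b c
    using that bound_three_directions[OF that(1)] unfolding H_def by blast
  have two: ?thesis if "distinct [a, b, c]" "H a" "H b" "\<not> H c" for a b c
    using that bound_two_directions[OF that(1)] unfolding H_def by blast
  have one: ?thesis if "distinct [a, b, c]" "\<not> H b" "\<not> H c" for a b c
    using that bound_one_direction[OF that(1)] unfolding H_def by blast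
  have d: "distinct [1, 2, 3 :: 3]" "distinct [2, 3, 1 :: 3]" "distinct [3, 1, 2 :: 3]" by simp_all
  show ?thesis
    using three[OF d(1)] two[OF d(1)] two[OF d(2)] two[OF d(3)]
      one[OF d(1)] one[OF d(2)] one[OF d(3)] by blast
qed

end

section \<open>Partitions of the cube and tilings by boxes of cells\<close>

text \<open>The solid box in space that consists of the given cells.\<close>
definition rbox :: "cell \<times> cell \<Rightarrow> (real ^ 3) set" where
  "rbox K = cbox (\<chi> i. real (lo K i)) (\<chi> i. real (hi K i))"

lemma mem_rbox: "x \<in> rbox K \<longleftrightarrow> (\<forall>i. real (lo K i) \<le> x $ i \<and> x $ i \<le> real (hi K i))"
  by (simp add: rbox_def mem_box_cart)

lemma mem_interior_rbox:
  "x \<in> interior (rbox K) \<longleftrightarrow> (\<forall>i. real (lo K i) < x $ i \<and> x $ i < real (hi K i))"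
  by (simp add: rbox_def interior_cbox mem_box_cart)

lemma mem_cube: "x \<in> cube n \<longleftrightarrow> (\<forall>i. 0 \<le> x $ i \<and> x $ i \<le> real n)"
  by (simp add: cube_def mem_box_cart)

lemma rbox_subset:
  assumes "\<And>i. lo K i \<le> hi K i"
  shows "rbox K \<subseteq> rbox K' \<longleftrightarrow> (\<forall>i. lo K' i \<le> lo K i \<and> hi K i \<le> hi K' i)"
proof
  assume "rbox K \<subseteq> rbox K'"
  moreover have "(\<chi> i. real (lo K i)) \<in> rbox K" "(\<chi> i. real (hi K i)) \<in> rbox K"
    using assms by (auto simp: mem_rbox)
  ultimately have "(\<chi> i. real (lo K i)) \<in> rbox K'" "(\<chi> i. real (hi K i)) \<in> rbox K'" by blast+
  then show "\<forall>i. lo K' i \<le> lo K i \<and> hi K i \<le> hi K' i" by (simp add: mem_rbox)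
next
  assume *: "\<forall>i. lo K' i \<le> lo K i \<and> hi K i \<le> hi K' i"
  show "rbox K \<subseteq> rbox K'"
  proof
    fix x assume x: "x \<in> rbox K"
    have "real (lo K' i) \<le> x $ i \<and> x $ i \<le> real (hi K' i)" for i
    proof -
      have "real (lo K' i) \<le> real (lo K i)" "real (hi K i) \<le> real (hi K' i)" using * by simp_all
      moreover have "real (lo K i) \<le> x $ i" "x $ i \<le> real (hi K i)" using x by (auto simp: mem_rbox)
      ultimately show ?thesis by linarith
    qed
    then show "x \<in> rbox K'" by (simp add: mem_rbox)
  qed
qed

lemma rbox_inj:
  assumes "rbox K = rbox K'" "\<And>i. lo K i \<le> hi K i" "\<And>i. lo K' i \<le> hi K' i"
  shows "K = K'"
proof (rule prod_eqI)
  have le: "\<forall>i. lo K' i \<le> lo K i \<and> hi K i \<le> hi K' i" "\<forall>i. lo K i \<le> lo K' i \<and> hi K' i \<le> hi K i"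
    using rbox_subset[OF assms(2), where K' = K'] rbox_subset[OF assms(3), where K' = K] assms(1)
    by auto
  show "lo K = lo K'" by (rule ext) (use le in \<open>meson le_antisym\<close>)
  show "hi K = hi K'" by (rule ext) (use le in \<open>meson le_antisym\<close>)
qed

lemma plane_meets_rbox:
  assumes "\<And>i. lo K i < hi K i"
  shows "{x. x $ d = real_of_int t} \<inter> interior (rbox K) = {}
    \<longleftrightarrow> \<not> (int (lo K d) < t \<and> t < int (hi K d))"
proof
  assume e: "{x. x $ d = real_of_int t} \<inter> interior (rbox K) = {}"
  show "\<not> (int (lo K d) < t \<and> t < int (hi K d))"
  proof
    assume t: "int (lo K d) < t \<and> t < int (hi K d)"
    define x :: "real ^ 3" where
      "x = (\<chi> i. if i = d then real_of_int t else (real (lo K i) + real (hi K i)) / 2)"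
    have "real (lo K i) < real (hi K i)" for i using assms by simp
    moreover have "real (lo K d) < real_of_int t" "real_of_int t < real (hi K d)" using t by linarith+
    ultimately have "x \<in> interior (rbox K)" by (auto simp: mem_interior_rbox x_def)
    moreover have "x $ d = real_of_int t" by (simp add: x_def)
    ultimately show False using e by blast
  qed
next
  assume n: "\<not> (int (lo K d) < t \<and> t < int (hi K d))"
  show "{x. x $ d = real_of_int t} \<inter> interior (rbox K) = {}"
  proof (rule ccontr)
    assume "{x. x $ d = real_of_int t} \<inter> interior (rbox K) \<noteq> {}"
    then obtain x where x: "x $ d = real_of_int t" "x \<in> interior (rbox K)" by blast
    have "real (lo K d) < x $ d \<and> x $ d < real (hi K d)"
      using x(2) by (simp add: mem_interior_rbox)
    then show False using n x(1) by linarith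
  qed
qed

text \<open>
  The face of the cell \<open>v\<close> shared with its successor in direction \<open>d\<close>, as a box that is degenerate in
  direction \<open>d\<close>.
\<close>
definition upper_face :: "3 \<times> cell \<Rightarrow> cell \<times> cell" where
  "upper_face = (\<lambda>(d, v). (v(d := Suc (v d)), \<lambda>i. Suc (v i)))"

lemma inj_upper_face: "inj upper_face"
proof (rule injI)
  fix p q assume eq: "upper_face p = upper_face q"
  obtain d v where p: "p = (d, v)" by fastforce
  obtain e w where q: "q = (e, w)" by fastforce
  have 1: "v(d := Suc (v d)) = w(e := Suc (w e))" and 2: "(\<lambda>i. Suc (v i)) = (\<lambda>i. Suc (w i))"
    using eq by (simp_all add: upper_face_def p q)
  have "v = w"
  proof
    fix i show "v i = w i" using fun_cong[OF 2, of i] by simp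
  qed
  moreover have "d = e" using fun_cong[OF 1, of d] \<open>v = w\<close> by (auto split: if_splits)
  ultimately show "p = q" by (simp add: p q)
qed

lemma upper_face_le: "lo (upper_face p) i \<le> hi (upper_face p) i"
  by (cases p) (simp add: upper_face_def)

lemma unit_square_upper_face: "unit_square (rbox (upper_face p))"
proof (cases p)
  case (Pair d v)
  let ?a = "(\<chi> i. real (lo (upper_face p) i)) :: real ^ 3"
  have "(\<chi> i. real (hi (upper_face p) i)) = (\<chi> i. if i = d then ?a $ i else ?a $ i + 1)"
    by (simp add: Pair upper_face_def vec_eq_iff)
  then have "rbox (upper_face p) = cbox ?a (\<chi> i. if i = d then ?a $ i else ?a $ i + 1)"
    by (simp add: rbox_def)
  moreover have "\<forall>i. ?a $ i \<in> \<int>" by simp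
  ultimately show ?thesis unfolding unit_square_def by blast
qed

lemma upper_face_subset:
  assumes "v \<in> cells K" "v(d := Suc (v d)) \<in> cells K'" 
  shows "rbox (upper_face (d, v)) \<subseteq> rbox K" and "rbox (upper_face (d, v)) \<subseteq> rbox K'"
proof -
  have K: "lo K i \<le> v i" "v i < hi K i" for i using assms(1) by (auto simp: cells_def)
  have K': "lo K' i \<le> (v(d := Suc (v d))) i" "(v(d := Suc (v d))) i < hi K' i" for i
    using assms(2) unfolding cells_def by blast+
  have "lo K i \<le> lo (upper_face (d, v)) i \<and> hi (upper_face (d, v)) i \<le> hi K i" for i
    using K[of i] by (auto simp: upper_face_def)
  then show "rbox (upper_face (d, v)) \<subseteq> rbox K"
    by (subst rbox_subset) (auto simp: upper_face_le)
  have "lo K' i \<le> lo (upper_face (d, v)) i \<and> hi (upper_face (d, v)) i \<le> hi K' i" for i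
    using K'[of i] by (auto simp: upper_face_def split: if_splits)
  then show "rbox (upper_face (d, v)) \<subseteq> rbox K'"
    by (subst rbox_subset) (auto simp: upper_face_le)
qed

context cube_tiling
begin

lemma rbox_inj_on: "inj_on rbox Q"
  by (rule inj_onI) (rule rbox_inj, auto intro: less_imp_le lo_less_hi)

lemma box_partition_rbox:
  assumes n0: "0 < n"
  shows "box_partition n (rbox ` Q)"
proof -
  have "rbox ` Q division_of cube n"
    unfolding division_of_def
  proof (intro conjI ballI impI)
    show "finite (rbox ` Q)" using finite_Q by simp
  next
    fix R assume "R \<in> rbox ` Q"
    then obtain K where K: "K \<in> Q" "R = rbox K" by blast
    show "R \<subseteq> cube n"
    proof
      fix x assume x: "x \<in> R"
      have "0 \<le> x $ i \<and> x $ i \<le> real n" for i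
      proof -
        have "real (lo K i) \<le> x $ i" "x $ i \<le> real (hi K i)" using x by (auto simp: K mem_rbox)
        moreover have "real (hi K i) \<le> real n" using hi_le[OF K(1)] by simp
        moreover have "0 \<le> real (lo K i)" by simp
        ultimately show ?thesis by linarith
      qed
      then show "x \<in> cube n" by (simp add: mem_cube)
    qed
    have "(\<chi> i. real (lo K i)) \<in> R" using lo_less_hi[OF K(1)] by (auto simp: K mem_rbox less_imp_le)
    then show "R \<noteq> {}" by blast
    show "\<exists>a b. R = cbox a b" by (auto simp: K rbox_def)
  next
    fix R R' assume "R \<in> rbox ` Q" "R' \<in> rbox ` Q" and ne: "R \<noteq> R'"
    then obtain K K' where K: "K \<in> Q" "R = rbox K" and K': "K' \<in> Q" "R' = rbox K'" by blast
    show "interior R \<inter> interior R' = {}"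
    proof (rule ccontr)
      assume "interior R \<inter> interior R' \<noteq> {}"
      then obtain x where x: "x \<in> interior (rbox K)" "x \<in> interior (rbox K')" by (auto simp: K K')
      define v where "v i = nat \<lfloor>x $ i\<rfloor>" for i
      have in_cells: "v \<in> cells A" if "x \<in> interior (rbox A)" for A
      proof -
        have "lo A i \<le> v i \<and> v i < hi A i" for i
        proof -
          have "real (lo A i) < x $ i" "x $ i < real (hi A i)"
            using that by (auto simp: mem_interior_rbox)
          then show ?thesis unfolding v_def by linarith
        qed
        then show ?thesis by (simp add: cells_def)
      qed
      have "K = K'" using box_unique[OF K(1) K'(1)] in_cells x by blast
      then show False using ne K K' by simp
    qed
  next
    show "\<Union> (rbox ` Q) = cube n"
    proof
      show "\<Union> (rbox ` Q) \<subseteq> cube n"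
      proof
        fix x assume "x \<in> \<Union> (rbox ` Q)"
        then obtain K where K: "K \<in> Q" "x \<in> rbox K" by blast
        have "0 \<le> x $ i \<and> x $ i \<le> real n" for i
        proof -
          have "real (lo K i) \<le> x $ i" "x $ i \<le> real (hi K i)" using K by (auto simp: mem_rbox)
          moreover have "real (hi K i) \<le> real n" using hi_le[OF K(1)] by simp
          moreover have "0 \<le> real (lo K i)" by simp
          ultimately show ?thesis by linarith
        qed
        then show "x \<in> cube n" by (simp add: mem_cube)
      qed
      show "cube n \<subseteq> \<Union> (rbox ` Q)"
      proof
        fix x assume "x \<in> cube n"
        then have x: "0 \<le> x $ i" "x $ i \<le> real n" for i by (auto simp: mem_cube)
        \<comment> \<open>The minimum takes care of points on the upper faces of the cube.\<close>
        define v where "v i = min (nat \<lfloor>x $ i\<rfloor>) (n - 1)" for i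
        have "v i < n" for i using n0 by (simp add: v_def min_less_iff_disj)
        then have vC: "v \<in> cube_cells" by (simp add: cube_cells_def)
        define K where "K = box_at v"
        have K: "K \<in> Q" "v \<in> cells K" using box_at[OF vC] by (simp_all add: K_def)
        have "real (lo K i) \<le> x $ i \<and> x $ i \<le> real (hi K i)" for i
        proof -
          have "lo K i \<le> v i" "v i < hi K i" using K(2) by (auto simp: cells_def)
          then show ?thesis using x[of i] n0 unfolding v_def min_def by (simp split: if_splits) linarith+
        qed
        then show "x \<in> \<Union> (rbox ` Q)" using K(1) by (auto simp: mem_rbox)
      qed
    qed
  qed
  moreover have "integer_box (rbox K)" if "K \<in> Q" for K
  proof -
    have "\<forall>i. (\<chi> i. real (lo K i)) $ i \<in> \<int> \<and> (\<chi> i. real (hi K i)) $ i \<in> \<int> \<and>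
        ((\<chi> i. real (lo K i)) :: real ^ 3) $ i < (\<chi> i. real (hi K i)) $ i"
      using lo_less_hi[OF that] by simp
    then show ?thesis unfolding integer_box_def rbox_def by blast
  qed
  ultimately show ?thesis by (auto simp: box_partition_def)
qed

lemma fault_plane_rbox:
  "fault_plane n (rbox ` Q) d t \<longleftrightarrow>
    0 < t \<and> t < int n \<and> (\<forall>K\<in>Q. \<not> (int (lo K d) < t \<and> t < int (hi K d)))"
proof -
  have "(\<forall>K\<in>Q. {x. x $ d = real_of_int t} \<inter> interior (rbox K) = {})
      \<longleftrightarrow> (\<forall>K\<in>Q. \<not> (int (lo K d) < t \<and> t < int (hi K d)))"
    by (intro ball_cong refl plane_meets_rbox lo_less_hi)
  then show ?thesis by (simp only: fault_plane_def ball_simps)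
qed

text \<open>
  The unit squares of the interface correspond to the faces: a square contained in two boxes lies at
  the upper end of one of them, since otherwise both contain the cell above it, and not at the upper
  end of the other, since otherwise both contain the cell below it.
\<close>
lemma internal_interface_rbox: "internal_interface (rbox ` Q) = card faces"
proof -
  let ?X = "{T. unit_square T \<and>
    (\<exists>R\<in>rbox ` Q. \<exists>R'\<in>rbox ` Q. R \<noteq> R' \<and> T \<subseteq> R \<and> T \<subseteq> R')}"
  have inj: "inj_on (\<lambda>p. rbox (upper_face p)) faces"
  proof (rule inj_onI)
    fix p q assume "rbox (upper_face p) = rbox (upper_face q)"
    then have "upper_face p = upper_face q" by (rule rbox_inj) (rule upper_face_le)+
    then show "p = q" using inj_upper_face by (simp add: inj_eq)
  qed
  have "?X = (\<lambda>p. rbox (upper_face p)) ` faces"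
  proof
    show "(\<lambda>p. rbox (upper_face p)) ` faces \<subseteq> ?X"
    proof
      fix s assume "s \<in> (\<lambda>p. rbox (upper_face p)) ` faces"
      then obtain d v where s: "s = rbox (upper_face (d, v))" and f: "(d, v) \<in> faces" by auto
      have vC: "v \<in> cube_cells" and wC: "v(d := Suc (v d)) \<in> cube_cells"
        using f by (auto simp: faces_def intro: cube_cells_upd)
      define K K' where "K = box_at v" and "K' = box_at (v(d := Suc (v d)))"
      have K: "K \<in> Q" "v \<in> cells K" and K': "K' \<in> Q" "v(d := Suc (v d)) \<in> cells K'"
        using box_at[OF vC] box_at[OF wC] by (simp_all add: K_def K'_def)
      have "K \<noteq> K'" using f K K' by (auto simp: faces_def)
      then have "rbox K \<noteq> rbox K'" using rbox_inj_on K K' by (auto dest: inj_onD)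
      then show "s \<in> ?X"
        using unit_square_upper_face[of "(d, v)"] upper_face_subset[OF K(2) K'(2)] K(1) K'(1)
        unfolding s by blast
    qed
    show "?X \<subseteq> (\<lambda>p. rbox (upper_face p)) ` faces"
    proof
      fix s assume "s \<in> ?X"
      then obtain R R' where us: "unit_square s" and R: "R \<in> rbox ` Q" "R' \<in> rbox ` Q" "R \<noteq> R'"
        and sR: "s \<subseteq> R" "s \<subseteq> R'" by blast
      obtain K K' where K: "K \<in> Q" "R = rbox K" and K': "K' \<in> Q" "R' = rbox K'" using R by blast
      have ne: "K \<noteq> K'" using R(3) K K' by auto
      obtain d and a :: "real ^ 3" where a: "\<And>i. a $ i \<in> \<int>"
        and s: "s = cbox a (\<chi> i. if i = d then a $ i else a $ i + 1)"
        using us unfolding unit_square_def by blast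
      have as: "a \<in> s" by (simp add: s mem_box_cart)
      then have a0: "0 \<le> a $ i" for i
      proof -
        have "real (lo K i) \<le> a $ i" using as sR(1) by (auto simp: K mem_rbox)
        then show ?thesis using of_nat_0_le_iff[of "lo K i", where 'a = real] by linarith
      qed
      define w where "w i = nat \<lfloor>a $ i\<rfloor>" for i
      have aw: "a $ i = real (w i)" for i
        using a[of i] a0[of i] by (auto simp: w_def elim!: Ints_cases)
      \<comment> \<open>The square as a degenerate box; \<open>w\<close> is the cell above it.\<close>
      define A where "A = (w, \<lambda>i. if i = d then w i else Suc (w i))"
      have sA: "s = rbox A"
      proof -
        have "a = (\<chi> i. real (lo A i))" by (simp add: vec_eq_iff A_def aw)
        moreover have "(\<chi> i. if i = d then a $ i else a $ i + 1) = (\<chi> i. real (hi A i))"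
          by (simp add: vec_eq_iff A_def aw)
        ultimately show ?thesis unfolding s rbox_def by metis
      qed
      have in_box: "lo B i \<le> w i" "(if i = d then w i else Suc (w i)) \<le> hi B i"
        if "s \<subseteq> rbox B" for B i
      proof -
        have "\<forall>i. lo B i \<le> lo A i \<and> hi A i \<le> hi B i"
          using that unfolding sA by (subst (asm) rbox_subset) (auto simp: A_def)
        then show "lo B i \<le> w i" "(if i = d then w i else Suc (w i)) \<le> hi B i"
          by (auto simp: A_def)
      qed
      have above: "w \<in> cells B" if "s \<subseteq> rbox B" "w d < hi B d" for B
      proof -
        have "lo B i \<le> w i \<and> w i < hi B i" for i
          using in_box[OF that(1), of i] that(2) by (auto split: if_splits)
        then show ?thesis by (simp add: cells_def)
      qed
      have below: "w(d := w d - 1) \<in> cells B \<and> 0 < w d"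
        if B: "B \<in> Q" "s \<subseteq> rbox B" and "\<not> w d < hi B d" for B
      proof -
        have h: "hi B d = w d" using in_box[OF B(2), of d] that(3) by simp
        then have p: "lo B d < w d" using lo_less_hi[OF B(1), of d] by simp
        have "lo B i \<le> (w(d := w d - 1)) i \<and> (w(d := w d - 1)) i < hi B i" for i
          using in_box[OF B(2), of i] h p by (auto split: if_splits)
        then show ?thesis using p unfolding cells_def by auto
      qed
      have face: "s \<in> (\<lambda>p. rbox (upper_face p)) ` faces"
        if B: "B \<in> Q" "s \<subseteq> rbox B" "\<not> w d < hi B d" and B': "B' \<in> Q" "s \<subseteq> rbox B'" "w d < hi B' d"
        for B B'
      proof -
        define v where "v = w(d := w d - 1)"
        have vB: "v \<in> cells B" and w0: "0 < w d" using below[OF B] by (simp_all add: v_def)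
        have wv: "w = v(d := Suc (v d))" using w0 by (simp add: v_def)
        have wB': "w \<in> cells B'" using above[OF B'(2,3)] .
        have "B \<noteq> B'" using B(3) B'(3) by auto
        have "w d < n" using wB' cells_subset_cube[OF B'(1)] by (auto simp: cube_cells_def)
        have "v \<in> cube_cells" using vB cells_subset_cube[OF B(1)] by blast
        have no: "\<not> (v \<in> cells D \<and> w \<in> cells D)" if D: "D \<in> Q" for D
          using box_unique[OF B(1) D vB] box_unique[OF B'(1) D wB'] \<open>B \<noteq> B'\<close> by blast
        have "Suc (v d) < n" using \<open>w d < n\<close> w0 by (simp add: v_def)
        then have "(d, v) \<in> faces" using \<open>v \<in> cube_cells\<close> no wv by (auto simp: faces_def)
        moreover have "upper_face (d, v) = A"
          using w0 by (auto simp: upper_face_def A_def v_def fun_eq_iff)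
        ultimately show ?thesis using sA by (metis image_eqI)
      qed
      have "(w d < hi K d) \<noteq> (w d < hi K' d)"
      proof
        assume e: "(w d < hi K d) = (w d < hi K' d)"
        show False
        proof (cases "w d < hi K d")
          case True
          then show False
            using above[of K] above[of K'] e sR K K' ne box_unique[OF K(1) K'(1)] by blast
        next
          case False
          then show False
            using below[of K] below[of K'] e sR K K' ne box_unique[OF K(1) K'(1)] by blast
        qed
      qed
      then show "s \<in> (\<lambda>p. rbox (upper_face p)) ` faces"
        using face[of K K'] face[of K' K] K K' sR by blast
    qed
  qed
  then show ?thesis
    unfolding internal_interface_def using card_image[OF inj] by simp
qed

end

text \<open>A cell lies in a box exactly if its centre does, and then the centre is an interior point.\<close>
lemma tiling_of_box_partition:
  assumes "box_partition n P"
  shows "\<exists>Q. cube_tiling n Q \<and> P = rbox ` Q"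
proof -
  have div: "P division_of cube n" and ib: "\<And>R. R \<in> P \<Longrightarrow> integer_box R"
    using assms by (auto simp: box_partition_def)
  define Q where "Q = {K. (\<forall>i. lo K i < hi K i) \<and> rbox K \<in> P}"
  have lt: "lo K i < hi K i" if "K \<in> Q" for K i using that by (auto simp: Q_def)
  have inP: "rbox K \<in> P" if "K \<in> Q" for K using that by (auto simp: Q_def)
  have inj: "inj_on rbox Q"
    by (rule inj_onI) (rule rbox_inj, auto intro: less_imp_le lt)
  have PQ: "P = rbox ` Q"
  proof
    show "rbox ` Q \<subseteq> P" using inP by blast
    show "P \<subseteq> rbox ` Q"
    proof
      fix R assume R: "R \<in> P"
      obtain a b where ab: "R = cbox a b" "\<And>i. a $ i \<in> \<int>" "\<And>i. b $ i \<in> \<int>" "\<And>i. a $ i < b $ i"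
        using ib[OF R] unfolding integer_box_def by blast
      have "a \<in> R" using ab by (auto simp: mem_box_cart less_imp_le)
      then have a0: "0 \<le> a $ i" for i using division_ofD(2)[OF div R] by (auto simp: mem_cube)
      define l h where "l i = nat \<lfloor>a $ i\<rfloor>" and "h i = nat \<lfloor>b $ i\<rfloor>" for i
      have la: "a $ i = real (l i)" for i
        using ab(2)[of i] a0[of i] by (auto simp: l_def elim!: Ints_cases)
      have b0: "0 \<le> b $ i" for i using a0[of i] ab(4)[of i] by linarith
      have hb: "b $ i = real (h i)" for i
        using ab(3)[of i] b0[of i] by (auto simp: h_def elim!: Ints_cases)
      have "a = (\<chi> i. real (l i))" "b = (\<chi> i. real (h i))" by (simp_all add: vec_eq_iff la hb)
      then have "R = rbox (l, h)" using ab(1) by (simp add: rbox_def)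
      moreover have "l i < h i" for i using ab(4)[of i] by (simp add: la hb)
      ultimately show "R \<in> rbox ` Q" using R by (auto simp: Q_def)
    qed
  qed
  have "cube_tiling n Q"
  proof
    show "finite Q" using finite_imageD[OF _ inj] division_of_finite[OF div] PQ by simp
    show "lo K i < hi K i" if "K \<in> Q" for K i using that by (rule lt)
    show "hi K i \<le> n" if K: "K \<in> Q" for K i
    proof -
      have "(\<chi> i. real (hi K i)) \<in> rbox K" using lt[OF K] by (auto simp: mem_rbox less_imp_le)
      then have "(\<chi> i. real (hi K i)) \<in> cube n" using division_ofD(2)[OF div inP[OF K]] by blast
      then show ?thesis by (simp add: mem_cube)
    qed
    show "\<exists>!K. K \<in> Q \<and> v \<in> cells K" if v: "\<And>i. v i < n" for v
    proof -
      define x :: "real ^ 3" where "x = (\<chi> i. real (v i) + 1 / 2)"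
      have "0 \<le> x $ i \<and> x $ i \<le> real n" for i
        using v[of i] by (simp add: x_def)
      then have "x \<in> cube n" by (simp add: mem_cube)
      then have "x \<in> \<Union> P" using division_ofD(6)[OF div] by simp
      then obtain K where K: "K \<in> Q" "x \<in> rbox K" using PQ by blast
      have "lo K i \<le> v i \<and> v i < hi K i" for i
      proof -
        have "real (lo K i) \<le> real (v i) + 1 / 2" "real (v i) + 1 / 2 \<le> real (hi K i)"
          using K(2) by (auto simp: mem_rbox x_def)
        then show ?thesis by linarith
      qed
      then have vK: "v \<in> cells K" by (simp add: cells_def)
      have int: "x \<in> interior (rbox B)" if "v \<in> cells B" for B
      proof -
        have "real (lo B i) < x $ i \<and> x $ i < real (hi B i)" for i
        proof -
          have "lo B i \<le> v i" "v i < hi B i" using that by (auto simp: cells_def)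
          then show ?thesis by (simp add: x_def)
        qed
        then show ?thesis by (simp add: mem_interior_rbox)
      qed
      show ?thesis
      proof (rule ex1I[of _ K])
        show "K \<in> Q \<and> v \<in> cells K" using K vK by blast
        fix B assume B: "B \<in> Q \<and> v \<in> cells B"
        have "rbox B = rbox K"
        proof (rule ccontr)
          assume "rbox B \<noteq> rbox K"
          then have "interior (rbox B) \<inter> interior (rbox K) = {}"
            using division_ofD(5)[OF div] inP B K(1) by blast
          then show False using int vK B by blast
        qed
        then show "B = K" using inj B K(1) by (auto dest: inj_onD)
      qed
    qed
  qed
  then show ?thesis using PQ by blast
qed

lemma internal_interface_ge:
  assumes "fault_free_six_partition n P"
  shows "2 * n\<^sup>2 + n \<le> internal_interface P"
proof -
  have bp: "box_partition n P" and c6: "card P = 6" and nf: "\<And>d i. \<not> fault_plane n P d i"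
    using assms by (auto simp: fault_free_six_partition_def)
  obtain Q where Q: "cube_tiling n Q" "P = rbox ` Q" using tiling_of_box_partition[OF bp] by blast
  interpret cube_tiling n Q by (rule Q(1))
  interpret fault_free_tiling n Q
  proof
    show "6 \<le> card Q" using c6 Q(2) card_image[OF rbox_inj_on] by simp
    show "\<exists>K\<in>Q. lo K d < t \<and> t < hi K d" if "0 < t" "t < n" for t d
      using nf[of d "int t"] that unfolding Q(2) fault_plane_rbox by auto
  qed
  show ?thesis using card_faces_ge internal_interface_rbox Q(2) by simp
qed

section \<open>An optimal fault-free partition\<close>

text \<open>The cell with the given three coordinates.\<close>
definition tri :: "nat \<Rightarrow> nat \<Rightarrow> nat \<Rightarrow> cell" where
  "tri x y z = (\<lambda>i. if i = 1 then x else if i = 2 then y else z)"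

lemma tri_simps [simp]: "tri x y z 1 = x" "tri x y z 2 = y" "tri x y z 3 = z"
  by (simp_all add: tri_def)

lemma tri_upd [simp]:
  "(tri x y z)(1 := t) = tri t y z" "(tri x y z)(2 := t) = tri x t z" "(tri x y z)(3 := t) = tri x y t"
  by (simp_all add: tri_def fun_eq_iff forall_3)

lemma tri_eq_iff [simp]: "tri x y z = tri x' y' z' \<longleftrightarrow> x = x' \<and> y = y' \<and> z = z'"
  by (auto simp: fun_eq_iff forall_3)

lemma tri_cases: obtains x y z where "v = tri x y z"
proof
  show "v = tri (v 1) (v 2) (v 3)" by (simp add: fun_eq_iff forall_3)
qed

lemma mem_cells_tri:
  "tri x y z \<in> cells (tri a b c, tri a' b' c') \<longleftrightarrow>
    a \<le> x \<and> x < a' \<and> b \<le> y \<and> y < b' \<and> c \<le> z \<and> z < c'"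
  by (auto simp: cells_def forall_3)

text \<open>
  An optimal fault-free tiling of the cube of side \<open>m + 1\<close>. The first three boxes span the three
  directions; the last two are the parts of a \<open>1 \<times> 1 \<times> m\<close> bar, which is why \<open>m \<ge> 2\<close> is needed.
\<close>
definition six_boxes :: "nat \<Rightarrow> (cell \<times> cell) set" where
  "six_boxes m =
    {(tri 0 0 0, tri (Suc m) m m),
     (tri 0 0 m, tri 1 (Suc m) (Suc m)),
     (tri 1 m 0, tri (Suc m) (Suc m) (Suc m)),
     (tri 1 0 m, tri (Suc m) m (Suc m)),
     (tri 0 m 0, tri 1 (Suc m) 1),
     (tri 0 m 1, tri 1 (Suc m) m)}"

lemma card_six_boxes: "2 \<le> m \<Longrightarrow> card (six_boxes m) = 6"
  by (simp add: six_boxes_def)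

lemma cube_tiling_six_boxes:
  assumes m: "2 \<le> m"
  shows "cube_tiling (Suc m) (six_boxes m)"
proof
  show "finite (six_boxes m)" by (simp add: six_boxes_def)
  show "lo K i < hi K i" if "K \<in> six_boxes m" for K i
  proof -
    have "\<forall>i. lo K i < hi K i" using that m unfolding forall_3 by (auto simp: six_boxes_def)
    then show ?thesis by blast
  qed
  show "hi K i \<le> Suc m" if "K \<in> six_boxes m" for K i
  proof -
    have "\<forall>i. hi K i \<le> Suc m" using that m unfolding forall_3 by (auto simp: six_boxes_def)
    then show ?thesis by blast
  qed
  show "\<exists>!K. K \<in> six_boxes m \<and> v \<in> cells K" if v: "\<And>i. v i < Suc m" for v
  proof -
    obtain x y z where xyz: "v = tri x y z" by (rule tri_cases)
    have b: "x < Suc m" "y < Suc m" "z < Suc m" using v[of 1] v[of 2] v[of 3] by (simp_all add: xyz)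
    \<comment> \<open>The box containing \<open>v\<close>, in the order of the definition of the tiling.\<close>
    define f where "f =
      (if y < m \<and> z < m then (tri 0 0 0, tri (Suc m) m m)
       else if x < 1 \<and> m \<le> z then (tri 0 0 m, tri 1 (Suc m) (Suc m))
       else if 1 \<le> x \<and> m \<le> y then (tri 1 m 0, tri (Suc m) (Suc m) (Suc m))
       else if 1 \<le> x then (tri 1 0 m, tri (Suc m) m (Suc m))
       else if z < 1 then (tri 0 m 0, tri 1 (Suc m) 1)
       else (tri 0 m 1, tri 1 (Suc m) m))"
    show ?thesis
    proof (rule ex1I[of _ f])
      show "f \<in> six_boxes m \<and> v \<in> cells f"
        using b m by (auto simp: f_def six_boxes_def xyz mem_cells_tri)
      show "K = f" if "K \<in> six_boxes m \<and> v \<in> cells K" for K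
        using that b m unfolding six_boxes_def xyz
        by (elim conjE insertE emptyE) (auto simp: f_def mem_cells_tri)
    qed
  qed
qed

lemma card_faces_six_boxes:
  assumes m: "2 \<le> m"
  shows "card (cube_tiling.faces (Suc m) (six_boxes m)) \<le> 2 * (Suc m)\<^sup>2 + Suc m"
proof -
  interpret cube_tiling "Suc m" "six_boxes m" using m by (rule cube_tiling_six_boxes)
  let ?N = "{..<Suc m}"
  \<comment> \<open>\<open>F1\<close> and \<open>F2\<close> lie in the plane \<open>x = 1\<close>, \<open>F3\<close> in \<open>y = m\<close> and \<open>F4\<close> in \<open>z = m\<close>;
    \<open>F5\<close> is the square that splits the bar.\<close>
  define F1 F2 F3 F4 F5 where
    "F1 = (\<lambda>y. (1 :: 3, tri 0 y m)) ` ?N" and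
    "F2 = (\<lambda>z. (1 :: 3, tri 0 m z)) ` {..<m}" and
    "F3 = (\<lambda>(x, z). (2 :: 3, tri x (m - 1) z)) ` (?N \<times> ?N - {(0, m)})" and
    "F4 = (\<lambda>(x, y). (3 :: 3, tri x y (m - 1))) ` (?N \<times> ?N - {1..<Suc m} \<times> {m})" and
    "F5 = {(3 :: 3, tri 0 m 0)}"
  have "faces \<subseteq> F1 \<union> F2 \<union> F3 \<union> F4 \<union> F5"
  proof
    fix p assume p: "p \<in> faces"
    obtain d x y z where dv: "p = (d, tri x y z)" by (metis surj_pair tri_cases)
    have b: "x < Suc m" "y < Suc m" "z < Suc m" and s: "Suc (tri x y z d) < Suc m"
      and no: "\<forall>K\<in>six_boxes m. \<not> (tri x y z \<in> cells K \<and> (tri x y z)(d := Suc (tri x y z d)) \<in> cells K)"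
      using p by (auto simp: dv faces_def cube_cells_def forall_3)
    consider "d = 1" | "d = 2" | "d = 3" using exhaust_3 by blast
    then show "p \<in> F1 \<union> F2 \<union> F3 \<union> F4 \<union> F5"
    proof cases
      case 1
      have "x = 0 \<and> (z = m \<or> y = m \<and> z < m)"
        using no b s m unfolding 1 six_boxes_def by (auto simp: mem_cells_tri)
      then have "p \<in> F1 \<union> F2" using b by (auto simp: dv 1 F1_def F2_def)
      then show ?thesis by blast
    next
      case 2
      have "y = m - 1 \<and> (x, z) \<noteq> (0, m)"
        using no b s m unfolding 2 six_boxes_def by (auto simp: mem_cells_tri)
      then have "p \<in> F3" using b by (auto simp: dv 2 F3_def)
      then show ?thesis by blast
    next
      case 3
      have "z = m - 1 \<and> \<not> (1 \<le> x \<and> y = m) \<or> x = 0 \<and> y = m \<and> z = 0"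
        using no b s m unfolding 3 six_boxes_def by (auto simp: mem_cells_tri)
      then have "p \<in> F4 \<union> F5" using b by (auto simp: dv 3 F4_def F5_def)
      then show ?thesis by blast
    qed
  qed
  then have "card faces \<le> card (F1 \<union> F2 \<union> F3 \<union> F4 \<union> F5)"
    by (intro card_mono) (auto simp: F1_def F2_def F3_def F4_def F5_def)
  also have "\<dots> \<le> card F1 + card F2 + card F3 + card F4 + card F5"
    by (intro order.trans[OF card_Un_le] add_mono order.refl)
  also have "\<dots> \<le> Suc m + m + ((Suc m)\<^sup>2 - 1) + ((Suc m)\<^sup>2 - m) + 1"
  proof (intro add_mono)
    show "card F1 \<le> Suc m" unfolding F1_def by (rule order.trans[OF card_image_le]) auto
    show "card F2 \<le> m" unfolding F2_def by (rule order.trans[OF card_image_le]) auto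
    have "card (?N \<times> ?N - {(0, m)}) = (Suc m)\<^sup>2 - 1"
      by (subst card_Diff_subset) (auto simp: card_cartesian_product power2_eq_square)
    then show "card F3 \<le> (Suc m)\<^sup>2 - 1"
      unfolding F3_def by (metis card_image_le finite_Diff finite_SigmaI finite_lessThan)
    have "card (?N \<times> ?N - {1..<Suc m} \<times> {m}) = (Suc m)\<^sup>2 - m"
      by (subst card_Diff_subset) (auto simp: card_cartesian_product power2_eq_square)
    then show "card F4 \<le> (Suc m)\<^sup>2 - m"
      unfolding F4_def by (metis card_image_le finite_Diff finite_SigmaI finite_lessThan)
    show "card F5 \<le> 1" by (simp add: F5_def)
  qed
  also have "\<dots> = 2 * (Suc m)\<^sup>2 + Suc m"
  proof -
    have "m \<le> (Suc m)\<^sup>2" "1 \<le> (Suc m)\<^sup>2" by (simp_all add: power2_eq_square)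
    then show ?thesis by linarith
  qed
  finally show ?thesis .
qed

lemma exists_fault_free_six_partition:
  assumes "3 \<le> n"
  shows "\<exists>P. fault_free_six_partition n P \<and> internal_interface P \<le> 2 * n\<^sup>2 + n"
proof -
  define m where "m = n - 1"
  have m: "2 \<le> m" and n: "n = Suc m" using assms by (auto simp: m_def)
  interpret cube_tiling n "six_boxes m" unfolding n using m by (rule cube_tiling_six_boxes)
  have "\<not> fault_plane n (rbox ` six_boxes m) d t" for d t
  proof -
    have "\<exists>K\<in>six_boxes m. lo K d = 0 \<and> hi K d = Suc m"
      using exhaust_3[of d] by (auto simp: six_boxes_def)
    then obtain K where "K \<in> six_boxes m" "lo K d = 0" "hi K d = n" using n by blast
    then show ?thesis unfolding fault_plane_rbox by force
  qed
  moreover have "box_partition n (rbox ` six_boxes m)" using n by (intro box_partition_rbox) simp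
  moreover have "card (rbox ` six_boxes m) = 6"
    using card_image[OF rbox_inj_on] card_six_boxes[OF m] by simp
  ultimately have "fault_free_six_partition n (rbox ` six_boxes m)"
    by (simp add: fault_free_six_partition_def)
  moreover have "internal_interface (rbox ` six_boxes m) \<le> 2 * n\<^sup>2 + n"
    using internal_interface_rbox card_faces_six_boxes[OF m] by (simp add: n)
  ultimately show ?thesis by blast
qed

theorem theorem2:
  fixes n :: nat
  assumes "n \<ge> 3"
  shows "(\<exists>P. fault_free_six_partition n P) \<and>
    I_ff n = 2 * n\<^sup>2 + n \<and> 2 * n\<^sup>2 + n = (2 * n + 1) choose 2"
proof (intro conjI)
  obtain P where P: "fault_free_six_partition n P" "internal_interface P \<le> 2 * n\<^sup>2 + n"
    using exists_fault_free_six_partition[OF assms] by blast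
  then show "\<exists>P. fault_free_six_partition n P" by blast
  have "internal_interface P = 2 * n\<^sup>2 + n"
    using P internal_interface_ge[OF P(1)] by simp
  then show "I_ff n = 2 * n\<^sup>2 + n"
    unfolding I_ff_def using P(1) internal_interface_ge by (intro Least_equality) blast+
  show "2 * n\<^sup>2 + n = (2 * n + 1) choose 2"
    by (simp add: choose_two power2_eq_square algebra_simps)
qed

end
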